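(* Let $d\ge 1$ be an integer, let $1 < q < \infty$, and let $D \subseteq \mathbb{Z}^d$. Write $D_N = D \cap R_N$, and suppose that the sequence of sets $\{D_N\}$ is universally pointwise $L^q$-good. Then there is a set $S \subseteq \mathbb{Z}^d$ such that, with $S_N = S \cap R_N$, the sequence $\{S_N\}$ is a perturbation of $\{D_N\}$, the sequence $\{S_N\}$ is universally pointwise $L^q$-good, and $\{S_N\}$ is universally $\infty$-sweeping out for $L^p$ for every $1\le p < q$.
   Context: $\#A$ denotes the cardinality of a set $A$. For a natural number $N$, $R_N = \{-N,\dots,N\}^d$ is the cube in $\mathbb{Z}^d$ of side length $2N+1$ centered at the origin. Actions: a free (aperiodic) $\mathbb{Z}^d$-action $(X,\mathcal{B},m,T)$ is a measure-preserving action $T=(T_g)_{g\in\mathbb{Z}^d}$ of $\mathbb{Z}^d$ on a measure space $(X,\mathcal{B},m)$ of finite measure such that for every $g\ne 0$ the set $\{x: T_g x = x\}$ has measure $0$. $L^p$ means $L^p(X,\mathcal{B},m)$. Good: a sequence $\{S_n\}$ of finite sets in $\mathbb{Z}^d$ is universally pointwise $L^p$-good ($p\ge1$) if for every free $\mathbb{Z}^d$-action and every $f\in L^p$, the averages $\frac{1}{\#S_n}\sum_{g\in S_n} f(T_g x)$ converge as $n\to\infty$ for a.e. $x\in X$. Sweeping out: $\{S_n\}$ is universally $\infty$-sweeping out for $L^p$ ($p\ge 1$) if for every free $\mathbb{Z}^d$-action there is $f\in L^p$ with $\sup_n \frac{1}{\#S_n}\sum_{g\in S_n} f(T_g x)=\infty$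 for a.e. $x\in X$. Perturbation: $\{S_n\}$ is a perturbation of $\{D_n\}$ if $\lim_{n\to\infty} \#(S_n\,\triangle\, D_n)/\#D_n = 0$, where $\triangle$ is symmetric difference. Averages and quotients are considered only for indices where the set in the denominator is nonempty.
   Formalization: Proved for infinite D of lower density zero (liminf #D_N/#R_N = 0) and for free actions on measure spaces countably separated modulo a null set; the claim fails for finite nonempty D, for D of positive lower density such as Z^d, and for trivial sigma-algebras. *)

theory Defs
  imports "HOL-Analysis.Analysis"
begin

definition cube :: "nat \<Rightarrow> (int ^ 'd::finite) set" where
  "cube N = {v. \<forall>i. \<bar>v $ i\<bar> \<le> int N}"

definition truncations :: "(int ^ 'd::finite) set \<Rightarrow> nat \<Rightarrow> (int ^ 'd) set" where
  "truncations D N = D \<inter> cube N"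

definition lower_density :: "(int ^ 'd::finite) set \<Rightarrow> ereal" where
  "lower_density D =
     liminf (\<lambda>N. ereal (real (card (truncations D N)) / real (card (cube N :: (int ^ 'd) set))))"

text \<open>
  Every standard Borel space and every Lebesgue space satisfies the following condition. Some
  condition of this kind is needed for the fixed-point definition of a free action to be
  meaningful: translation on the integers with the trivial sigma-algebra and total mass 1 has no
  fixed points, although its measure algebra is trivial.
\<close>

definition countably_separated :: "'a measure \<Rightarrow> bool" where
  "countably_separated M \<longleftrightarrow>
     (\<exists>Z \<A>. Z \<in> null_sets M \<and> countable \<A> \<and> \<A> \<subseteq> sets M \<and>
        (\<forall>x\<in>space M - Z. \<forall>y\<in>space M - Z. x \<noteq> y \<longrightarrow> (\<exists>A\<in>\<A>. (x \<in> A) \<noteq> (y \<in> A))))"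

locale free_action = finite_measure M
  for M :: "'a measure" and T :: "int ^ 'd::finite \<Rightarrow> 'a \<Rightarrow> 'a" +
  assumes countably_separated: "countably_separated M"
    and measurable_action: "T g \<in> measurable M M"
    and measure_preserving: "distr M M (T g) = M"
    and action_zero: "x \<in> space M \<Longrightarrow> T 0 x = x"
    and action_add: "x \<in> space M \<Longrightarrow> T (g + h) x = T g (T h x)"
    and free: "g \<noteq> 0 \<Longrightarrow> {x \<in> space M. T g x = x} \<in> null_sets M"

definition in_Lp :: "real \<Rightarrow> 'a measure \<Rightarrow> ('a \<Rightarrow> real) \<Rightarrow> bool" where
  "in_Lp p M f \<longleftrightarrow> f \<in> borel_measurable M \<and> integrable M (\<lambda>x. \<bar>f x\<bar> powr p)"

definition average ::
    "(int ^ 'd::finite \<Rightarrow> 'a \<Rightarrow> 'a) \<Rightarrow> (int ^ 'd) set \<Rightarrow> ('a \<Rightarrow> real) \<Rightarrow> 'a \<Rightarrow> real" where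
  "average T A f x = (\<Sum>g\<in>A. f (T g x)) / real (card A)"

text \<open>
  Averages and quotients are taken only over the indices with a nonempty denominator; limits are
  therefore along the following filter (which is trivial if almost all the sets are empty).
\<close>

definition nonempty_at_top :: "(nat \<Rightarrow> 'b set) \<Rightarrow> nat filter" where
  "nonempty_at_top S = inf sequentially (principal {n. S n \<noteq> {}})"

text \<open>
  The type argument is the type of the points of the underlying spaces. A countably separated
  space injects, up to a null set, into the reals, so \<^typ>\<open>real\<close> as type argument
  already accounts for all free actions up to isomorphism.
\<close>

definition universally_good ::
    "'a itself \<Rightarrow> real \<Rightarrow> (nat \<Rightarrow> (int ^ 'd::finite) set) \<Rightarrow> bool" where
  "universally_good _ p S \<longleftrightarrow>
     (\<forall>(M :: 'a measure) (T :: int ^ 'd \<Rightarrow> 'a \<Rightarrow> 'a) f.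
        free_action M T \<longrightarrow> in_Lp p M f \<longrightarrow>
        (AE x in M. \<exists>l. ((\<lambda>n. average T (S n) f x) \<longlongrightarrow> l) (nonempty_at_top S)))"

definition universally_sweeping_out ::
    "'a itself \<Rightarrow> real \<Rightarrow> (nat \<Rightarrow> (int ^ 'd::finite) set) \<Rightarrow> bool" where
  "universally_sweeping_out _ p S \<longleftrightarrow>
     (\<forall>(M :: 'a measure) (T :: int ^ 'd \<Rightarrow> 'a \<Rightarrow> 'a).
        free_action M T \<longrightarrow>
        (\<exists>f. in_Lp p M f \<and>
           (AE x in M. (SUP n\<in>{n. S n \<noteq> {}}. ereal (average T (S n) f x)) = \<infinity>)))"

definition perturbation :: "(nat \<Rightarrow> 'b set) \<Rightarrow> (nat \<Rightarrow> 'b set) \<Rightarrow> bool" where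
  "perturbation S D \<longleftrightarrow>
     ((\<lambda>n. real (card ((S n - D n) \<union> (D n - S n))) / real (card (D n))) \<longlongrightarrow> 0)
       (nonempty_at_top D)"

end

theory Submission imports Defs begin

text \<open>
  The set \<open>S\<close> is \<open>D\<close> together with sparse finite blocks \<open>E\<^sub>k\<close>, each placed between the cubes of sizes
  \<open>L\<^sub>k div 2\<close> and \<open>L\<^sub>k\<close> and having about \<open>\<epsilon>\<^sub>k\<close> times as many points as \<open>D\<close> has in the larger cube.

  Goodness in \<open>L\<^sup>q\<close> depends on the sizes alone. The blocks change an average of \<open>f\<close> by about \<open>\<epsilon>\<^sub>k\<close>
  times a mean value of \<open>f\<close>, and by convexity the \<open>q\<close>-th power of this has integral
  \<open>O(\<epsilon>\<^sub>k\<^sup>q)\<close>. If \<open>\<epsilon>\<^sub>k\<^sup>q\<close> is summable, the change tends to zero almost everywhere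
  (\<open>sparse_sums_tendsto_zero\<close>).

  For \<open>p < q\<close> the series of the \<open>\<epsilon>\<^sub>k\<^sup>p\<close> is made to diverge. On level \<open>b\<close> there are
  \<open>K\<^sub>b\<close> blocks, about \<open>2\<^sup>b\<^sup>q / b\<^sup>2\<close> in number, all of relative size \<open>2\<^sup>-\<^sup>b\<close>, and the \<open>s\<close>-th of them
  lies in the residue class \<open>s\<close> modulo \<open>K\<^sub>b\<close> of one fixed coordinate. A free action contains
  approximately periodic patterns (\<open>exists_periodic_pattern_set\<close>): a set \<open>A\<close> of relative measure at most
  \<open>1 / K\<^sub>b\<close> such that, for all points outside a set of small measure, one of the \<open>K\<^sub>b\<close> blocks translates the
  point entirely into \<open>A\<close>. A function of size \<open>b 2\<^sup>b\<close> on \<open>A\<close> then has an average of order \<open>b\<close> along that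
  block, although its \<open>p\<close>-th moment is of order \<open>b\<^sup>p 2\<^sup>b\<^sup>p / K\<^sub>b\<close>, which is summable
  (\<open>exists_function_large_on_periodic_sets\<close>).

  The blocks need room. The set \<open>D\<close> should not grow by more than a constant factor between \<open>L\<^sub>k div 2\<close>
  and \<open>L\<^sub>k\<close>, as otherwise the first points of a block would weigh too much against \<open>D\<close>, and every residue class
  in the shell between the two cubes should have more points than \<open>D\<close> has in the larger cube. Lower density zero
  provides such scales (\<open>exists_doubling_scale\<close>).
\<close>

section \<open>Cubes and truncations\<close>

lemma card_vec_box:
  fixes A :: "int set"
  assumes "finite A"
  shows "finite {v :: int ^ 'd::finite. \<forall>i. v $ i \<in> A}"
    and "card {v :: int ^ 'd. \<forall>i. v $ i \<in> A} = card A ^ CARD('d)"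
proof -
  let ?P = "PiE (UNIV :: 'd set) (\<lambda>_. A)"
  have bij: "bij_betw vec_lambda ?P {v :: int ^ 'd. \<forall>i. v $ i \<in> A}"
    by (rule bij_betwI[where g = vec_nth]) auto
  have "finite ?P"
    using assms by (intro finite_PiE) auto
  then show "finite {v :: int ^ 'd::finite. \<forall>i. v $ i \<in> A}"
    using bij bij_betw_finite by blast
  show "card {v :: int ^ 'd. \<forall>i. v $ i \<in> A} = card A ^ CARD('d)"
    using bij_betw_same_card[OF bij] by (simp add: card_PiE)
qed

lemma cube_eq_box: "cube N = {v. \<forall>i. v $ i \<in> {- int N..int N}}"
  by (auto simp: cube_def abs_le_iff) (metis minus_le_iff)+

lemma finite_cube [simp]: "finite (cube N)"
  unfolding cube_eq_box by (rule card_vec_box) simp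

lemma card_cube: "card (cube N :: (int ^ 'd::finite) set) = (2 * N + 1) ^ CARD('d)"
proof -
  have "nat (1 + int N + int N) = 2 * N + 1" by simp
  then show ?thesis
    unfolding cube_eq_box by (subst card_vec_box) simp_all
qed

lemma cube_mono: "m \<le> n \<Longrightarrow> cube m \<subseteq> cube n"
  unfolding cube_def by (auto intro: order_trans)

lemma zero_in_cube [simp]: "0 \<in> cube n"
  by (simp add: cube_def)

lemma uminus_in_cube_iff [simp]: "- g \<in> cube n \<longleftrightarrow> g \<in> cube n"
  by (simp add: cube_def)

lemma add_in_cube: "g \<in> cube m \<Longrightarrow> h \<in> cube n \<Longrightarrow> g + h \<in> cube (m + n)"
proof -
  assume *: "g \<in> cube m" "h \<in> cube n"
  have "\<bar>g $ i + h $ i\<bar> \<le> int m + int n" for i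
    using * abs_triangle_ineq[of "g $ i" "h $ i"] by (force simp: cube_def intro: order_trans add_mono)
  then show ?thesis by (simp add: cube_def)
qed

lemma diff_in_cube: "g \<in> cube m \<Longrightarrow> h \<in> cube n \<Longrightarrow> g - h \<in> cube (m + n)"
  using add_in_cube[of g m "- h" n] by simp

lemma vec_in_some_cube: "\<exists>n. g \<in> cube n"
proof
  have "\<bar>g $ i\<bar> \<le> (\<Sum>j\<in>UNIV. \<bar>g $ j\<bar>)" for i
    by (rule member_le_sum) auto
  then show "g \<in> cube (nat (\<Sum>j\<in>UNIV. \<bar>g $ j\<bar>))"
    by (auto simp: cube_def sum_nonneg)
qed

lemma finite_set_in_some_cube:
  assumes "finite F"
  shows "\<exists>n. F \<subseteq> cube n"
  using assms
proof (induction F)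
  case (insert g F)
  obtain m n where "F \<subseteq> cube m" "g \<in> cube n"
    using insert.IH vec_in_some_cube by blast
  then have "insert g F \<subseteq> cube (max m n)"
    using cube_mono[of m "max m n"] cube_mono[of n "max m n"] by auto
  then show ?case by blast
qed simp

lemma finite_truncations [simp]: "finite (truncations D N)"
  by (simp add: truncations_def)

lemma truncations_mono: "m \<le> n \<Longrightarrow> truncations D m \<subseteq> truncations D n"
  using cube_mono unfolding truncations_def by blast

lemma card_truncations_mono: "m \<le> n \<Longrightarrow> card (truncations D m) \<le> card (truncations D n)"
  by (simp add: card_mono truncations_mono)

lemma card_truncations_unbounded:
  assumes "infinite D"
  shows "\<exists>N. \<forall>n\<ge>N. c \<le> card (truncations D n)"
proof -
  obtain F where F: "finite F" "card F = c" "F \<subseteq> D"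
    using infinite_arbitrarily_large[OF assms] by blast
  then obtain N where "F \<subseteq> cube N"
    using finite_set_in_some_cube by blast
  then have "F \<subseteq> truncations D n" if "n \<ge> N" for n
    using F cube_mono[OF that] unfolding truncations_def by blast
  then show ?thesis
    using F by (metis card_mono finite_truncations)
qed

lemma nonempty_at_top_eq_sequentially:
  assumes "infinite D"
  shows "nonempty_at_top (truncations D) = sequentially"
proof -
  have "\<forall>\<^sub>F n in sequentially. truncations D n \<noteq> {}"
    using card_truncations_unbounded[OF assms, of 1] unfolding eventually_sequentially
    by (metis card.empty not_one_le_zero)
  then show ?thesis
    unfolding nonempty_at_top_def by (intro inf_absorb1) (simp add: le_principal)
qed

text \<open>
  Shells of fixed thickness are negligible, even against a cube of half the size. This is what makes
  the boundary effects in the construction of periodic patterns small.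
\<close>
lemma card_shell_div_card_cube_tendsto:
  "(\<lambda>n. real (card (cube (n + a) - cube (n - a) :: (int ^ 'd::finite) set))
      / real (card (cube (n div 2) :: (int ^ 'd) set))) \<longlonglongrightarrow> 0"
proof (rule tendsto_sandwich[OF _ _ tendsto_const])
  define d where "d = CARD('d)"
  have lim: "(\<lambda>n. a / real n) \<longlonglongrightarrow> 0" for a
    by (rule lim_const_over_n)
  have "(\<lambda>n. (2 + (2 * real a + 1) / real n) ^ d - (2 + (1 - 2 * real a) / real n) ^ d) \<longlonglongrightarrow> (2 + 0) ^ d - (2 + 0) ^ d"
    by (intro tendsto_intros lim)
  then show "(\<lambda>n. (2 + (2 * real a + 1) / real n) ^ d - (2 + (1 - 2 * real a) / real n) ^ d) \<longlonglongrightarrow> 0"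
    by simp
  show "\<forall>\<^sub>F n in sequentially. real (card (cube (n + a) - cube (n - a) :: (int ^ 'd::finite) set))
      / real (card (cube (n div 2) :: (int ^ 'd) set))
     \<le> (2 + (2 * real a + 1) / real n) ^ d - (2 + (1 - 2 * real a) / real n) ^ d"
    using eventually_ge_at_top[of "a + 1"]
  proof eventually_elim
    case (elim n)
    have sub: "cube (n - a) \<subseteq> (cube (n + a) :: (int ^ 'd) set)"
      by (rule cube_mono) simp
    have "real (card (cube (n + a) - cube (n - a) :: (int ^ 'd::finite) set))
        = real (card (cube (n + a) :: (int ^ 'd) set)) - real (card (cube (n - a) :: (int ^ 'd) set))"
      using sub by (simp add: card_Diff_subset of_nat_diff card_mono)
    also have "\<dots> = (2 * (real n + real a) + 1) ^ d - (2 * (real n - real a) + 1) ^ d"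
      using elim by (simp add: card_cube d_def of_nat_diff algebra_simps)
    finally have num: "real (card (cube (n + a) - cube (n - a) :: (int ^ 'd::finite) set)) = \<dots>" .
    have "n \<le> 2 * (n div 2) + 1" by presburger
    then have "n ^ d \<le> (2 * (n div 2) + 1) ^ d" by (rule power_mono) simp
    then have den: "real n ^ d \<le> real (card (cube (n div 2) :: (int ^ 'd) set))"
      unfolding card_cube d_def of_nat_power[symmetric] of_nat_le_iff .
    have "real (card (cube (n + a) - cube (n - a) :: (int ^ 'd::finite) set))
      / real (card (cube (n div 2) :: (int ^ 'd) set))
      \<le> real (card (cube (n + a) - cube (n - a) :: (int ^ 'd::finite) set)) / real n ^ d"
      using den elim by (intro divide_left_mono mult_pos_pos) (auto simp: card_cube simp del: of_nat_power)
    also have "\<dots> = ((2 * (real n + real a) + 1) / real n) ^ d - ((2 * (real n - real a) + 1) / real n) ^ d"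
      unfolding num by (simp add: diff_divide_distrib power_divide)
    also have "(2 * (real n + real a) + 1) / real n = 2 + (2 * real a + 1) / real n"
      using elim by (simp add: field_simps)
    also have "(2 * (real n - real a) + 1) / real n = 2 + (1 - 2 * real a) / real n"
      using elim by (simp add: field_simps)
    finally show ?case .
  qed
qed auto

section \<open>Sparse blocks in residue classes\<close>

lemma card_cube_halving:
  "card (cube L :: (int ^ 'd::finite) set) \<le> 3 ^ CARD('d) * card (cube (L div 2) :: (int ^ 'd) set)"
proof -
  have "2 * L + 1 \<le> 3 * (2 * (L div 2) + 1)" by presburger
  then show ?thesis
    unfolding card_cube power_mult_distrib[symmetric] by (intro power_mono) auto
qed

text \<open>
  This is where lower density zero enters. A scale of small density always exists, but the set
  may have gained most of its points in the last shell; then the scale \<open>L div 2\<close> is no denser than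
  \<open>L\<close>, and one descends. The descent must stop, for otherwise the density at arbitrarily large scales
  would be at least the positive one near a fixed scale.
\<close>
lemma exists_doubling_scale:
  fixes D :: "(int ^ 'd::finite) set"
  assumes D: "infinite D" "lower_density D = 0" and "\<delta> > 0"
  shows "\<exists>L\<ge>N. real (card (truncations D L)) \<le> \<delta> * real (card (cube L :: (int ^ 'd) set)) \<and>
           card (truncations D L) \<le> 3 ^ CARD('d) * card (truncations D (L div 2))"
proof (rule ccontr)
  define u where "u n = card (truncations D n)" for n
  define r where "r n = card (cube n :: (int ^ 'd) set)" for n
  assume "\<not> ?thesis"
  then have neg: "3 ^ CARD('d) * u (L div 2) < u L" if "L \<ge> N" "u L \<le> \<delta> * r L" for L
    using that unfolding u_def r_def by (metis linorder_not_less)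
  have r_pos: "r n > 0" for n
    by (simp add: r_def card_cube)
  obtain N1 where N1: "\<And>n. n \<ge> N1 \<Longrightarrow> u n \<ge> 1"
    using card_truncations_unbounded[OF D(1), of 1] unfolding u_def by blast
  define N0 where "N0 = max N (2 * N1 + 2)"
  \<comment> \<open>Halving a large scale of density at most \<open>\<delta>\<close> does not increase the density now. So the lower bound
    valid between \<open>N0 div 2\<close> and \<open>N0\<close>, where \<open>D\<close> already has a point, persists.\<close>
  have bound: "u L \<le> \<delta> * r L \<Longrightarrow> L \<ge> N0 div 2 \<Longrightarrow> u L / r L \<ge> 1 / r N0" for L
  proof (induction L rule: less_induct)
    case (less L)
    show ?case
    proof (cases "L < N0")
      case True
      have "u L \<ge> 1"
        using less.prems N1[of L] by (auto simp: N0_def)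
      moreover have "r L \<le> r N0"
        using True unfolding r_def by (intro card_mono cube_mono) auto
      ultimately show ?thesis
        using r_pos[of L] r_pos[of N0] by (intro frac_le) auto
    next
      case False
      then have NL: "N \<le> L" by (simp add: N0_def)
      have "real (3 ^ CARD('d) * u (L div 2)) \<le> real (u L)"
        using neg[of L] less.prems NL unfolding of_nat_le_iff by simp
      moreover have "real (r L) \<le> real (3 ^ CARD('d) * r (L div 2))"
        using card_cube_halving[of L, where 'd='d] unfolding r_def of_nat_le_iff .
      ultimately have "real (3 ^ CARD('d) * u (L div 2)) * r L \<le> real (u L) * real (3 ^ CARD('d) * r (L div 2))"
        by (intro mult_mono) auto
      then have le: "u (L div 2) / r (L div 2) \<le> u L / r L"
        using r_pos[of L] r_pos[of "L div 2"] by (simp add: field_simps)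
      have "u L / r L \<le> \<delta>"
        using less.prems r_pos[of L] by (simp add: field_simps)
      with le have "u (L div 2) / r (L div 2) \<le> \<delta>" by (rule order_trans)
      then have "u (L div 2) \<le> \<delta> * r (L div 2)"
        using r_pos[of "L div 2"] by (simp add: field_simps)
      moreover have "L div 2 < L" "L div 2 \<ge> N0 div 2"
        using False by (auto simp: N0_def)
      ultimately show ?thesis
        using less.IH[of "L div 2"] le by simp
    qed
  qed
  have "\<forall>\<^sub>F n in sequentially. ereal (min \<delta> (1 / r N0)) \<le> ereal (u n / r n)"
    unfolding eventually_sequentially
  proof (intro exI allI impI)
    fix n assume "N0 \<le> n"
    then have n: "n \<ge> N0 div 2" by simp
    show "ereal (min \<delta> (1 / r N0)) \<le> ereal (u n / r n)"
    proof (cases "u n \<le> \<delta> * r n")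
      case True
      have "min \<delta> (1 / r N0) \<le> u n / r n"
        using bound[OF True n] by (rule min.coboundedI2)
      then show ?thesis by (simp only: ereal_less_eq)
    next
      case False
      then have "\<delta> \<le> u n / r n" using r_pos[of n] by (simp add: field_simps)
      then show ?thesis by (simp only: ereal_less_eq min.coboundedI1)
    qed
  qed
  then have "ereal (min \<delta> (1 / r N0)) \<le> lower_density D"
    unfolding lower_density_def u_def r_def by (rule Liminf_bounded)
  then have "min \<delta> (1 / r N0) \<le> 0"
    unfolding D(2) by (simp only: ereal_less_eq flip: zero_ereal_def)
  then show False
    using \<open>\<delta> > 0\<close> r_pos[of N0] by (simp add: min_le_iff_disj)
qed

text \<open>
  The points \<open>m + K w\<close>, with \<open>w\<close> ranging over a discrete box and \<open>m\<close> a fixed corner of the right residue,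
  already fill a fixed proportion of the cube. A set of density below \<open>(12 K)\<^sup>-\<^sup>d\<close> is therefore
  outnumbered by each residue class modulo \<open>K\<close> inside the shell.
\<close>
lemma card_residue_class_in_shell:
  fixes K :: nat and a :: int and i0 :: "'d::finite"
  assumes K: "K > 0" and L: "L \<ge> 4 * K"
  shows "\<exists>Q \<subseteq> cube L - cube (L div 2) :: (int ^ 'd) set.
           (\<forall>v\<in>Q. int K dvd v $ i0 - a) \<and> card (cube L :: (int ^ 'd) set) \<le> (12 * K) ^ CARD('d) * card Q"
proof -
  define M where "M = L div 2"
  define r where "r = (L - M) div K"
  define s where "s = (a - int M - 1) mod int K"
  define W where "W = {w :: int ^ 'd. \<forall>i. w $ i \<in> {0..<int r}}"
  define p where "p w = (\<chi> i. int M + 1 + s + int K * w $ i)" for w :: "int ^ 'd"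
  have s: "0 \<le> s" "s < int K" using K by (auto simp: s_def)
  have "inj p"
    using K by (auto simp: inj_def p_def vec_eq_iff)
  then have card: "card (p ` W) = r ^ CARD('d)"
    using card_vec_box(2)[of "{0..<int r}", where 'd = 'd]
    by (subst card_image) (auto simp: W_def intro: inj_on_subset)
  have range: "int M < p w $ i \<and> p w $ i \<le> int L" if "w \<in> W" for w i
  proof -
    have w: "0 \<le> w $ i" "w $ i \<le> int r - 1" using that by (auto simp: W_def)
    have "int K * w $ i \<le> int K * (int r - 1)" using w by (intro mult_left_mono) auto
    also have "\<dots> = int K * int r - int K" by (simp add: algebra_simps)
    finally have below: "int K * w $ i \<le> int K * int r - int K" .
    have "int K * int r \<le> int L - int M"
    proof -
      have "K * r \<le> L - M" by (simp add: r_def)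
      moreover have "M \<le> L" by (simp add: M_def)
      ultimately show ?thesis by (metis of_nat_diff of_nat_le_iff of_nat_mult)
    qed
    with below have "int K * w $ i \<le> int L - int M - int K" by linarith
    moreover have "0 \<le> int K * w $ i" using w by simp
    ultimately show ?thesis unfolding p_def vec_lambda_beta using s by (intro conjI; linarith)
  qed
  have sub: "p ` W \<subseteq> cube L - cube M"
  proof (intro subsetI DiffI)
    fix v assume "v \<in> p ` W"
    then have v: "int M < v $ i" "v $ i \<le> int L" for i
      using range by auto
    then have "\<bar>v $ i\<bar> \<le> int L" for i
      using v(1)[of i] v(2)[of i] by linarith
    then show "v \<in> cube L" by (simp add: cube_def)
    have "\<not> \<bar>v $ i0\<bar> \<le> int M" using v(1)[of i0] by linarith
    then show "v \<notin> cube M" by (auto simp: cube_def)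
  qed
  have dvd: "int K dvd v $ i0 - a" if "v \<in> p ` W" for v
  proof -
    from that obtain w where v: "v = p w" by blast
    have "int K dvd (a - int M - 1) - s"
      by (simp add: s_def)
    then have "int K dvd int K * w $ i0 - ((a - int M - 1) - s)"
      by (rule dvd_diff[OF dvd_triv_left])
    moreover have "v $ i0 - a = int K * w $ i0 - ((a - int M - 1) - s)"
      by (simp add: v p_def)
    ultimately show ?thesis by metis
  qed
  have "2 * L + 1 \<le> 12 * K * r"
  proof -
    have "L - M < K * (r + 1)"
      using K unfolding r_def by (simp add: mult.commute) (metis dividend_less_times_div mult.commute)
    moreover have "2 * (L - M) \<ge> L" by (simp add: M_def)
    ultimately have "L < 2 * (K * r) + 2 * K" by simp
    then show ?thesis using L K by linarith
  qed
  then have "(2 * L + 1) ^ CARD('d) \<le> (12 * K * r) ^ CARD('d)"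
    by (intro power_mono) auto
  then have "card (cube L :: (int ^ 'd) set) \<le> (12 * K) ^ CARD('d) * card (p ` W)"
    unfolding card_cube card by (simp add: power_mult_distrib)
  then show ?thesis using sub dvd by (intro exI[of _ "p ` W"]) (auto simp: M_def)
qed

text \<open>
  The inductive step of the construction. The number \<open>m\<close> counts the points added before; the new scale
  is taken so large that they weigh no more than the new block.
\<close>
lemma exists_sparse_block:
  fixes D :: "(int ^ 'd::finite) set" and e :: real and K m N :: nat and a :: int and i0 :: 'd
  assumes D: "infinite D" "lower_density D = 0" and e: "0 < e" "e \<le> 1" and K: "K > 0"
  shows "\<exists>L E. 0 < L \<and> N \<le> L div 2 \<and> E \<subseteq> cube L - cube (L div 2) \<and>
           (\<forall>v\<in>E. int K dvd v $ i0 - a) \<and>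
           e * card (truncations D L) \<le> 2 * card E \<and>
           m + card E \<le> 2 * e * card (truncations D L) \<and>
           card (truncations D L) \<le> 3 ^ CARD('d) * card (truncations D (L div 2)) \<and>
           truncations D (L div 2) \<noteq> {}"
proof -
  define c where "c = nat \<lceil>(real m + 1) / e\<rceil>"
  obtain N' where N': "\<And>n. n \<ge> N' \<Longrightarrow> c \<le> card (truncations D n)"
    using card_truncations_unbounded[OF D(1)] by blast
  define \<delta> :: real where "\<delta> = 1 / (12 * real K) ^ CARD('d)"
  have "\<delta> > 0" using K by (simp add: \<delta>_def)
  from exists_doubling_scale[OF D this, of "max (2 * N) (max (4 * K) N')"]
  obtain L where L: "L \<ge> 2 * N" "L \<ge> 4 * K" "L \<ge> N'"
    and density: "real (card (truncations D L)) \<le> \<delta> * real (card (cube L :: (int ^ 'd) set))"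
    and doubling: "card (truncations D L) \<le> 3 ^ CARD('d) * card (truncations D (L div 2))"
    by auto
  define u where "u = card (truncations D L)"
  have "(real m + 1) / e \<le> real c"
    unfolding c_def by linarith
  also have "real c \<le> real u"
    using N'[of L] L by (simp add: u_def)
  finally have u: "real m + 1 \<le> e * u"
    using e by (simp add: field_simps)
  obtain Q :: "(int ^ 'd) set" where Q: "Q \<subseteq> cube L - cube (L div 2)" "\<And>v. v \<in> Q \<Longrightarrow> int K dvd v $ i0 - a"
    and cardQ: "card (cube L :: (int ^ 'd) set) \<le> (12 * K) ^ CARD('d) * card Q"
    using card_residue_class_in_shell[OF K L(2), of i0 a] by blast
  have "real (card (cube L :: (int ^ 'd) set)) \<le> real ((12 * K) ^ CARD('d) * card Q)"
    using cardQ by (simp only: of_nat_le_iff)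
  then have "\<delta> * real (card (cube L :: (int ^ 'd) set)) \<le> card Q"
    using K by (simp add: \<delta>_def field_simps)
  with density have "real u \<le> card Q" by (simp add: u_def)
  define n where "n = nat \<lfloor>e * u\<rfloor>"
  have n: "real n \<le> e * u" "e * u \<le> 2 * n"
  proof -
    have "1 \<le> \<lfloor>e * u\<rfloor>" using u by (simp add: le_floor_iff)
    moreover have "real n = of_int \<lfloor>e * u\<rfloor>"
      using \<open>1 \<le> \<lfloor>e * u\<rfloor>\<close> by (simp add: n_def)
    ultimately show "real n \<le> e * u" "e * u \<le> 2 * n" by linarith+
  qed
  have "e * u \<le> 1 * real u"
    using e by (intro mult_right_mono) auto
  with n \<open>real u \<le> card Q\<close> have "n \<le> card Q" by linarith
  then obtain E where E: "E \<subseteq> Q" "card E = n"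
    by (meson obtain_subset_with_card_n)
  have "u > 0" using u e by (cases u) auto
  then have "card (truncations D (L div 2)) > 0"
    using doubling by (cases "card (truncations D (L div 2))") (auto simp: u_def)
  then have "truncations D (L div 2) \<noteq> {}" by auto
  moreover have "0 < L" "N \<le> L div 2" using L K by auto
  moreover have "m + card E \<le> 2 * e * u"
    using n u E by simp
  moreover have "e * u \<le> 2 * card E"
    using n E by simp
  moreover have "E \<subseteq> cube L - cube (L div 2)" "\<forall>v\<in>E. int K dvd v $ i0 - a"
    using E Q by auto
  ultimately show ?thesis
    using doubling unfolding u_def by blast
qed

text \<open>
  Block \<open>k\<close> has about \<open>e k\<close> times as many points as \<open>D\<close> has at scale \<open>L k\<close>, and so has, up to
  a factor 2, the union of the first blocks. That the block avoids the cube of half the scale keeps it from being seen before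
  \<open>D\<close> has attained a fixed proportion of these points.
\<close>
lemma exists_sparse_blocks:
  fixes D :: "(int ^ 'd::finite) set" and e :: "nat \<Rightarrow> real" and K :: "nat \<Rightarrow> nat" and a :: "nat \<Rightarrow> int"
    and i0 :: 'd
  assumes D: "infinite D" "lower_density D = 0" and e: "\<And>k. 0 < e k" "\<And>k. e k \<le> 1" and K: "\<And>k. K k > 0"
  obtains L :: "nat \<Rightarrow> nat" and E :: "nat \<Rightarrow> (int ^ 'd) set" where
    "\<And>k. 0 < L k" "\<And>k. L k \<le> L (Suc k) div 2"
    "\<And>k. E k \<subseteq> cube (L k) - cube (L k div 2)"
    "\<And>k v. v \<in> E k \<Longrightarrow> int (K k) dvd v $ i0 - a k"
    "\<And>k. e k * card (truncations D (L k)) \<le> 2 * card (E k)"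
    "\<And>k. card (\<Union>j\<le>k. E j) \<le> 2 * e k * card (truncations D (L k))"
    "\<And>k. card (truncations D (L k)) \<le> 3 ^ CARD('d) * card (truncations D (L k div 2))"
    "\<And>k. truncations D (L k div 2) \<noteq> {}"
proof -
  define block where "block k L E \<longleftrightarrow> 0 < L \<and> E \<subseteq> cube L - cube (L div 2) \<and>
           (\<forall>v\<in>E. int (K k) dvd v $ i0 - a k) \<and>
           e k * card (truncations D L) \<le> 2 * card E \<and>
           card (truncations D L) \<le> 3 ^ CARD('d) * card (truncations D (L div 2)) \<and>
           truncations D (L div 2) \<noteq> {}" for k L and E :: "(int ^ 'd) set"
  have step: "\<exists>L E. block k L E \<and> N \<le> L div 2 \<and> m + card E \<le> 2 * e k * card (truncations D L)" for k N m
    using exists_sparse_block[OF D e[of k] K[of k], of N i0 "a k" m] unfolding block_def by blast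
  \<comment> \<open>A state consists of a scale, a block, and the points of all the blocks so far.\<close>
  define valid where "valid k s \<longleftrightarrow> (case s of (L, E, P) \<Rightarrow> block k L E \<and> finite P \<and>
      card P \<le> 2 * e k * card (truncations D L) \<and> (k = 0 \<longrightarrow> P = E))" for k s
  define succ where "succ s s' \<longleftrightarrow> fst s \<le> fst s' div 2 \<and> snd (snd s') = snd (snd s) \<union> fst (snd s')"
    for s s' :: "nat \<times> (int ^ 'd) set \<times> (int ^ 'd) set"
  have finite_block: "finite E" if "block k L E" for k L E
    using that unfolding block_def by (meson finite_cube finite_Diff finite_subset)
  have "\<exists>s. \<forall>k. valid k (s k) \<and> succ (s k) (s (Suc k))"
  proof (rule dependent_nat_choice)
    obtain L E where "block 0 L E" "0 + card E \<le> 2 * e 0 * card (truncations D L)"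
      using step[of 0 0 0] by auto
    then show "\<exists>s. valid 0 s"
      using finite_block by (intro exI[of _ "(L, E, E)"]) (simp add: valid_def)
  next
    fix s k
    assume *: "valid k s"
    obtain L E P where s: "s = (L, E, P)" by (cases s)
    obtain L' E' where new: "block (Suc k) L' E'" "L \<le> L' div 2"
        "card P + card E' \<le> 2 * e (Suc k) * card (truncations D L')"
      using step[of "Suc k" L "card P"] by blast
    have "real (card (P \<union> E')) \<le> card P + card E'"
      using card_Un_le[of P E'] by linarith
    then show "\<exists>t. valid (Suc k) t \<and> succ s t"
      using new * s finite_block[OF new(1)]
      by (intro exI[of _ "(L', E', P \<union> E')"]) (simp add: valid_def succ_def)
  qed
  then obtain s where s: "\<forall>k. valid k (s k) \<and> succ (s k) (s (Suc k))" ..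
  define L where "L k = fst (s k)" for k
  define E where "E k = fst (snd (s k))" for k
  define P where "P k = snd (snd (s k))" for k
  have block: "block k (L k) (E k)" and card: "card (P k) \<le> 2 * e k * card (truncations D (L k))" for k
    using s[rule_format, of k] by (simp_all add: L_def E_def P_def valid_def split_beta)
  have P0: "P 0 = E 0"
    using s[rule_format, of 0] by (simp add: E_def P_def valid_def split_beta)
  have L: "L k \<le> L (Suc k) div 2" and PSuc: "P (Suc k) = P k \<union> E (Suc k)" for k
    using s[rule_format, of k] by (simp_all add: L_def E_def P_def succ_def)
  have P: "P k = (\<Union>j\<le>k. E j)" for k
    by (induction k) (auto simp: P0 PSuc atMost_Suc)
  show ?thesis
  proof (rule that[of L E])
    fix k
    show "0 < L k" "E k \<subseteq> cube (L k) - cube (L k div 2)"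
      "e k * card (truncations D (L k)) \<le> 2 * card (E k)"
      "card (truncations D (L k)) \<le> 3 ^ CARD('d) * card (truncations D (L k div 2))"
      "truncations D (L k div 2) \<noteq> {}"
      using block[of k] by (simp_all add: block_def)
    show "int (K k) dvd v $ i0 - a k" if "v \<in> E k" for v
      using block[of k] that by (simp add: block_def)
    show "card (\<Union>j\<le>k. E j) \<le> 2 * e k * card (truncations D (L k))"
      using card[of k] by (simp add: P)
  qed (rule L)
qed

section \<open>Almost everywhere convergence of sparse sums\<close>

lemma AE_summable_of_summable_integrals:
  fixes F :: "nat \<Rightarrow> 'a \<Rightarrow> real"
  assumes int: "\<And>k. integrable M (F k)" and nonneg: "\<And>k x. x \<in> space M \<Longrightarrow> 0 \<le> F k x"
    and sum: "summable (\<lambda>k. \<integral>x. F k x \<partial>M)"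
  shows "AE x in M. summable (\<lambda>k. F k x)"
proof -
  have [measurable]: "F k \<in> borel_measurable M" for k
    using int by auto
  have "(\<integral>\<^sup>+x. (\<Sum>k. ennreal (F k x)) \<partial>M) = (\<Sum>k. \<integral>\<^sup>+x. ennreal (F k x) \<partial>M)"
    by (rule nn_integral_suminf) simp
  also have "\<dots> = (\<Sum>k. ennreal (\<integral>x. F k x \<partial>M))"
    using int nonneg by (intro suminf_cong nn_integral_eq_integral) auto
  also have "\<dots> \<noteq> \<infinity>"
    using sum nonneg by (subst suminf_ennreal2) (auto intro!: integral_nonneg_AE)
  finally have "AE x in M. (\<Sum>k. ennreal (F k x)) \<noteq> \<infinity>"
    by (intro nn_integral_PInf_AE) auto
  then show ?thesis
  proof (rule AE_mp, intro AE_I2 impI)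
    fix x assume "x \<in> space M" "(\<Sum>k. ennreal (F k x)) \<noteq> \<infinity>"
    then show "summable (\<lambda>k. F k x)"
      using nonneg by (intro summable_suminf_not_top) auto
  qed
qed

lemma mean_powr_le_powr_mean:
  fixes t :: "'b \<Rightarrow> real"
  assumes q: "1 < q" and t: "\<And>g. g \<in> P \<Longrightarrow> 0 \<le> t g"
  shows "((\<Sum>g\<in>P. t g) / card P) powr q \<le> (\<Sum>g\<in>P. t g powr q) / card P"
proof (cases "card P = 0")
  case False
  define m where "m = (\<Sum>g\<in>P. t g) / card P"
  have m: "0 \<le> m"
    using t by (simp add: m_def sum_nonneg)
  define r where "r = q / (q - 1)"
  have r: "1 < r" "1 / q + 1 / r = 1"
    using q by (auto simp: r_def field_simps)
  show ?thesis
  proof (cases "m = 0")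
    case True
    then show ?thesis using t unfolding m_def[symmetric] by (auto intro!: sum_nonneg divide_nonneg_nonneg)
  next
    case m0: False
    have mm: "m * m powr (q - 1) = m powr q"
      using m m0 by (metis powr_mult_base diff_add_cancel add.commute)
    have rr: "(m powr (q - 1)) powr r = m powr q"
      using q by (simp add: powr_powr r_def)
    \<comment> \<open>Young's inequality gives the tangent line of the \<open>q\<close>-th power at the mean.\<close>
    have young: "t g * m powr (q - 1) \<le> t g powr q / q + m powr q / r" if "g \<in> P" for g
      using Youngs_inequality[OF q r(1) r(2) t[OF that], of "m powr (q - 1)"] rr by simp
    have "m powr q = (\<Sum>g\<in>P. t g * m powr (q - 1)) / card P"
      unfolding mm[symmetric] by (simp add: sum_distrib_right[symmetric]) (simp add: m_def)
    also have "\<dots> \<le> (\<Sum>g\<in>P. t g powr q / q + m powr q / r) / card P"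
      by (intro divide_right_mono sum_mono young) auto
    also have "\<dots> = (\<Sum>g\<in>P. t g powr q) / card P / q + m powr q / r"
      using False by (simp add: sum.distrib sum_divide_distrib[symmetric] add_divide_distrib)
    finally have "m powr q * (1 - 1 / r) \<le> (\<Sum>g\<in>P. t g powr q) / card P / q"
      by (simp add: algebra_simps)
    moreover have "1 - 1 / r = 1 / q" using r by simp
    ultimately have "m powr q * (1 / q) \<le> (\<Sum>g\<in>P. t g powr q) / card P * (1 / q)" by simp
    then show ?thesis
      unfolding m_def[symmetric] by (rule mult_right_le_imp_le) (use q in simp)
  qed
qed simp

context free_action
begin

declare measurable_action [measurable]

lemma action_in_space: "x \<in> space M \<Longrightarrow> T g x \<in> space M"
  using measurable_action by (rule measurable_space)

lemma integrable_translate: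
  fixes h :: "'a \<Rightarrow> real"
  assumes "integrable M h"
  shows "integrable M (\<lambda>x. h (T g x))"
  using integrable_distr[OF measurable_action, of g h] assms by (simp add: measure_preserving)

lemma integral_translate:
  fixes h :: "'a \<Rightarrow> real"
  assumes "h \<in> borel_measurable M"
  shows "(\<integral>x. h (T g x) \<partial>M) = (\<integral>x. h x \<partial>M)"
  using integral_distr[OF measurable_action, of h g] assms by (simp add: measure_preserving)

lemma measure_translate:
  assumes "A \<in> sets M"
  shows "measure M {x \<in> space M. T g x \<in> A} = measure M A"
proof -
  have "measure M A = measure (distr M M (T g)) A"
    by (simp add: measure_preserving)
  also have "\<dots> = measure M (T g -` A \<inter> space M)"
    using assms by (simp add: measure_distr)
  finally show ?thesis by (simp add: vimage_def Int_def conj_commute)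
qed

lemma AE_translate:
  assumes "AE x in M. Q x"
  shows "AE x in M. \<forall>g. Q (T g x)"
proof -
  have "AE x in distr M M (T g). Q x" for g
    unfolding measure_preserving by (rule assms)
  then have "AE x in M. Q (T g x)" for g
    by (rule AE_distrD[OF measurable_action])
  then show ?thesis by (simp add: AE_all_countable)
qed

text \<open>
  The sum is at most \<open>e k\<close> times a mean of \<open>\<bar>f\<bar>\<close> over translates. By convexity its \<open>q\<close>-th power
  integrates to at most \<open>e k powr q\<close> times the integral of \<open>\<bar>f\<bar> powr q\<close>. These bounds have a finite sum
  over \<open>k\<close>, so almost everywhere the \<open>q\<close>-th powers are summable and tend to zero.
\<close>
lemma sparse_sums_tendsto_zero:
  fixes P :: "nat \<Rightarrow> (int ^ 'd) set" and b e :: "nat \<Rightarrow> real"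
  assumes q: "1 < q" and f: "in_Lp q M f"
    and e: "\<And>k. 0 \<le> e k" "summable (\<lambda>k. e k powr q)"
    and b: "\<And>k. 0 < b k" and P: "\<And>k. card (P k) \<le> e k * b k" 
  shows "AE x in M. (\<lambda>k. (\<Sum>g\<in>P k. \<bar>f (T g x)\<bar>) / b k) \<longlonglongrightarrow> 0"
proof -
  have f_meas[measurable]: "f \<in> borel_measurable M" and f_int: "integrable M (\<lambda>x. \<bar>f x\<bar> powr q)"
    using f by (auto simp: in_Lp_def)
  define G where "G k x = e k powr q * ((\<Sum>g\<in>P k. \<bar>f (T g x)\<bar> powr q) / card (P k))" for k x
  have bound: "((\<Sum>g\<in>P k. \<bar>f (T g x)\<bar>) / b k) powr q \<le> G k x" for k x
  proof (cases "card (P k) = 0")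
    case True
    then have "P k = {} \<or> infinite (P k)" by auto
    then show ?thesis using q by (auto simp: G_def)
  next
    case False
    let ?A = "(\<Sum>g\<in>P k. \<bar>f (T g x)\<bar>)"
    have "?A / b k = (card (P k) / b k) * (?A / card (P k))"
      using False by simp
    also have "\<dots> \<le> e k * (?A / card (P k))"
      using P[of k] b[of k] by (intro mult_right_mono) (auto simp: field_simps sum_nonneg)
    finally have "(?A / b k) powr q \<le> (e k * (?A / card (P k))) powr q"
      using q b[of k] by (intro powr_mono2) (auto simp: sum_nonneg less_imp_le)
    also have "\<dots> = e k powr q * (?A / card (P k)) powr q"
      by (rule powr_mult)
    also have "\<dots> \<le> G k x"
      unfolding G_def using q by (intro mult_left_mono mean_powr_le_powr_mean) auto
    finally show ?thesis .
  qed
  have G_int: "integrable M (G k)" for k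
    unfolding G_def by (intro integrable_mult_right integrable_divide Bochner_Integration.integrable_sum
        integrable_translate[OF f_int])
  have "(\<integral>x. G k x \<partial>M) = e k powr q * ((\<Sum>g\<in>P k. \<integral>x. \<bar>f (T g x)\<bar> powr q \<partial>M) / card (P k))" for k
    unfolding G_def using integrable_translate[OF f_int] by (simp add: Bochner_Integration.integral_sum)
  also have "\<dots> k = e k powr q * ((\<Sum>g\<in>P k. \<integral>x. \<bar>f x\<bar> powr q \<partial>M) / card (P k))" for k
    by (subst integral_translate[where h = "\<lambda>x. \<bar>f x\<bar> powr q"]) auto
  finally have G_integral: "(\<integral>x. G k x \<partial>M) \<le> e k powr q * (\<integral>x. \<bar>f x\<bar> powr q \<partial>M)" for k
    by simp
  have "summable (\<lambda>k. \<integral>x. G k x \<partial>M)"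
  proof (rule summable_comparison_test')
    show "summable (\<lambda>k. e k powr q * (\<integral>x. \<bar>f x\<bar> powr q \<partial>M))"
      using e by (intro summable_mult2)
    show "norm (\<integral>x. G k x \<partial>M) \<le> e k powr q * (\<integral>x. \<bar>f x\<bar> powr q \<partial>M)" if "k \<ge> 0" for k
    proof -
      have "0 \<le> (\<integral>x. G k x \<partial>M)"
        by (intro integral_nonneg_AE AE_I2) (auto simp: G_def sum_nonneg)
      then show ?thesis using G_integral by simp
    qed
  qed
  then have "AE x in M. summable (\<lambda>k. G k x)"
    by (intro AE_summable_of_summable_integrals G_int) (auto simp: G_def sum_nonneg)
  then show ?thesis
  proof (rule AE_mp, intro AE_I2 impI)
    fix x assume "summable (\<lambda>k. G k x)"
    then have "(\<lambda>k. G k x) \<longlonglongrightarrow> 0" by (rule summable_LIMSEQ_zero)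
    then have "(\<lambda>k. ((\<Sum>g\<in>P k. \<bar>f (T g x)\<bar>) / b k) powr q) \<longlonglongrightarrow> 0"
      by (rule tendsto_sandwich[OF always_eventually always_eventually tendsto_const, rotated 2])
        (use bound in simp_all)
    then have "(\<lambda>k. (((\<Sum>g\<in>P k. \<bar>f (T g x)\<bar>) / b k) powr q) powr (1 / q)) \<longlonglongrightarrow> 0 powr (1 / q)"
      using q by (intro tendsto_powr') (auto simp: less_imp_le)
    then show "(\<lambda>k. (\<Sum>g\<in>P k. \<bar>f (T g x)\<bar>) / b k) \<longlonglongrightarrow> 0"
      using q b by (simp add: powr_powr powr_one sum_nonneg less_imp_le)
  qed
qed

end

section \<open>Approximately periodic patterns in free actions\<close>

text \<open>
  The first differing digit contributes more than all the later ones together.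
\<close>
lemma ternary_series_separates:
  fixes u v :: "nat \<Rightarrow> bool"
  assumes "(\<Sum>n. of_bool (u n) * (1/3::real) ^ n) = (\<Sum>n. of_bool (v n) * (1/3) ^ n)"
  shows "u = v"
proof (rule ccontr)
  assume "u \<noteq> v"
  then have ex: "\<exists>n. u n \<noteq> v n" by auto
  define k where "k = (LEAST n. u n \<noteq> v n)"
  have before: "u n = v n" if "n < k" for n
    using not_less_Least[of n "\<lambda>n. u n \<noteq> v n"] that unfolding k_def by auto
  have k: "u k \<noteq> v k"
    using LeastI_ex[OF ex] unfolding k_def .
  define w where "w n = (of_bool (u n) - of_bool (v n)) * (1/3::real) ^ n" for n
  have sums: "summable (\<lambda>n. of_bool (z n) * (1/3::real) ^ n)" for z :: "nat \<Rightarrow> bool"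
    by (rule summable_comparison_test'[OF summable_geometric[of "1/3"]]) (auto simp: of_bool_def)
  have w: "summable w" "suminf w = 0"
    using summable_diff[OF sums[of u] sums[of v]] suminf_diff[OF sums[of u] sums[of v]] assms
    by (simp_all add: w_def[abs_def] algebra_simps)
  have tail: "summable (\<lambda>n. w (n + Suc k))"
    using w(1) by (subst summable_iff_shift)
  have geo: "(\<lambda>n. (1/3::real) ^ (n + Suc k)) sums ((1/3) ^ Suc k * (3/2))"
    using sums_mult[OF geometric_sums[of "1/3::real"], of "(1/3) ^ Suc k"] by (simp add: power_add mult.commute)
  have "suminf w = (\<Sum>n. w (n + Suc k)) + (\<Sum>n<Suc k. w n)"
    by (rule suminf_split_initial_segment[OF w(1)])
  also have "(\<Sum>n<Suc k. w n) = w k"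
    using before by (simp add: w_def)
  finally have "\<bar>w k\<bar> = \<bar>\<Sum>n. w (n + Suc k)\<bar>"
    using w(2) by simp
  also have "\<dots> \<le> (\<Sum>n. (1/3) ^ (n + Suc k))"
  proof -
    have le: "norm (w (n + Suc k)) \<le> (1/3) ^ (n + Suc k)" for n
      by (auto simp: w_def of_bool_def)
    have "norm (\<Sum>n. w (n + Suc k)) \<le> (\<Sum>n. (1/3) ^ (n + Suc k))"
      by (rule norm_suminf_le) (use le sums_summable[OF geo] in auto)
    then show ?thesis by simp
  qed
  also have "\<dots> = (1/3) ^ k * (1/2)"
    using sums_unique[OF geo] by simp
  also have "\<dots> < (1/3) ^ k" by simp
  also have "(1/3) ^ k = \<bar>w k\<bar>"
    using k by (auto simp: w_def)
  finally show False by simp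
qed

context free_action
begin

text \<open>
  Coding the separating family by ternary digits gives a real function that is injective outside a null
  set. It serves two purposes below: cutting the space into pieces that are disjoint from their small
  translates, and comparing points of one orbit in a way that does not depend on a base point.
\<close>
lemma exists_orbit_separating_function:
  "\<exists>\<phi> \<in> borel_measurable M. AE x in M. \<forall>g h. g \<noteq> h \<longrightarrow> \<phi> (T g x) \<noteq> (\<phi> (T h x) :: real)"
proof -
  obtain Z \<A> where Z: "Z \<in> null_sets M" and \<A>: "countable \<A>" "\<A> \<subseteq> sets M"
    and sep: "\<And>x y. x \<in> space M - Z \<Longrightarrow> y \<in> space M - Z \<Longrightarrow> x \<noteq> y \<Longrightarrow> \<exists>A\<in>\<A>. (x \<in> A) \<noteq> (y \<in> A)"
  proof -
    obtain Z \<A> where *: "Z \<in> null_sets M \<and> countable \<A> \<and> \<A> \<subseteq> sets M \<and>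
        (\<forall>x\<in>space M - Z. \<forall>y\<in>space M - Z. x \<noteq> y \<longrightarrow> (\<exists>A\<in>\<A>. (x \<in> A) \<noteq> (y \<in> A)))"
      using countably_separated unfolding countably_separated_def by (elim exE)
    show ?thesis by (rule that[of Z \<A>]) (use * in simp_all)
  qed
  define A where "A = from_nat_into (insert {} \<A>)"
  have range: "range A = insert {} \<A>"
    unfolding A_def using \<A> by (intro range_from_nat_into) auto
  have [measurable]: "A n \<in> sets M" for n
    using \<A> range by (metis insert_subset rangeI sets.empty_sets subset_iff)
  define \<phi> :: "'a \<Rightarrow> real" where "\<phi> x = (\<Sum>n. of_bool (x \<in> A n) * (1/3) ^ n)" for x
  have "\<phi> \<in> borel_measurable M"
    unfolding \<phi>_def by measurable
  moreover have "AE x in M. \<forall>g h. g \<noteq> h \<longrightarrow> \<phi> (T g x) \<noteq> \<phi> (T h x)"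
  proof -
    have "AE x in M. T g x \<noteq> x" if "g \<noteq> 0" for g
      using free[OF that] by (rule AE_I') auto
    then have "AE x in M. \<forall>g. g \<noteq> 0 \<longrightarrow> T g x \<noteq> x"
      by (simp add: AE_all_countable)
    then have "AE x in M. \<forall>h g. g \<noteq> 0 \<longrightarrow> T g (T h x) \<noteq> T h x"
      by (rule AE_translate)
    moreover have "AE x in M. \<forall>h. T h x \<notin> Z"
      using AE_not_in[OF Z] by (rule AE_translate)
    ultimately show ?thesis
      using AE_space
    proof eventually_elim
      case (elim x)
      show ?case
      proof (intro allI impI notI)
        fix g h assume gh: "g \<noteq> h" and eq: "\<phi> (T g x) = \<phi> (T h x)"
        have "T g x = T (g - h) (T h x)"
          using action_add[OF elim(3), of "g - h" h] by simp
        then have "T g x \<noteq> T h x"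
          using elim(1) gh by simp
        then obtain B where B: "B \<in> \<A>" "(T g x \<in> B) \<noteq> (T h x \<in> B)"
          using sep[of "T g x" "T h x"] elim action_in_space by auto
        moreover obtain n where "B = A n"
          using B range by (metis imageE insertI2)
        moreover have "(\<lambda>n. T g x \<in> A n) = (\<lambda>n. T h x \<in> A n)"
          using eq unfolding \<phi>_def by (rule ternary_series_separates)
        ultimately show False by (metis (no_types))
      qed
    qed
  qed
  ultimately show ?thesis by blast
qed

text \<open>
  A maximal \<open>n\<close>-separated set. It is obtained greedily along a countable cover \<open>U\<close> of almost all of the
  space by sets that are themselves separated, adding at each stage those points of \<open>U i\<close> that see no
  earlier marker in their cube. The pieces \<open>U\<close> exist because \<open>\<phi>\<close> takes distinct values at the
  finitely many points of a cube in the orbit: the gap is at least some \<open>1 / Suc k\<close>, while \<open>\<phi>\<close> varies by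
  less than that on a piece.
\<close>
lemma exists_marker_set:
  fixes \<phi> :: "'a \<Rightarrow> real"
  assumes [measurable]: "\<phi> \<in> borel_measurable M"
    and orbit: "AE x in M. \<forall>g h. g \<noteq> h \<longrightarrow> \<phi> (T g x) \<noteq> \<phi> (T h x)"
  shows "\<exists>B \<in> sets M. (\<forall>x\<in>space M. \<forall>g\<in>cube n. g \<noteq> 0 \<longrightarrow> x \<in> B \<longrightarrow> T g x \<notin> B) \<and>
           (AE x in M. \<exists>g\<in>cube n. T g x \<in> B)"
proof -
  define U where "U i = (case from_nat i of (k :: nat, j :: int) \<Rightarrow>
      {x \<in> space M. (\<forall>g\<in>cube n - {0}. 1 / real (Suc k) < \<bar>\<phi> (T g x) - \<phi> x\<bar>) \<and>
         j / real (Suc k) \<le> \<phi> x \<and> \<phi> x < (j + 1) / real (Suc k)})" for i :: nat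
  have [measurable]: "U i \<in> sets M" for i
    unfolding U_def by (cases "from_nat i :: nat \<times> int") simp
  have U_sep: "T g x \<notin> U i" if "x \<in> U i" "g \<in> cube n" "g \<noteq> 0" for x g i
  proof
    assume *: "T g x \<in> U i"
    obtain k j where kj: "from_nat i = (k :: nat, j :: int)" by (cases "from_nat i :: nat \<times> int")
    have "1 / real (Suc k) < \<bar>\<phi> (T g x) - \<phi> x\<bar>"
      using that by (auto simp: U_def kj)
    moreover have "j / real (Suc k) \<le> \<phi> x" "\<phi> x < j / real (Suc k) + 1 / real (Suc k)"
        "j / real (Suc k) \<le> \<phi> (T g x)" "\<phi> (T g x) < j / real (Suc k) + 1 / real (Suc k)"
      using that * unfolding U_def kj by (auto simp: add_divide_distrib)
    ultimately show False by linarith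
  qed
  have U_cover: "\<exists>i. x \<in> U i" if x: "x \<in> space M" and inj: "\<And>g h. g \<noteq> h \<Longrightarrow> \<phi> (T g x) \<noteq> \<phi> (T h x)" for x
  proof -
    define \<delta> where "\<delta> = Min (insert 1 ((\<lambda>g. \<bar>\<phi> (T g x) - \<phi> x\<bar>) ` (cube n - {0})))"
    have "\<bar>\<phi> (T g x) - \<phi> x\<bar> > 0" if "g \<noteq> 0" for g
      using inj[OF that] action_zero[OF x] by simp
    then have "\<delta> > 0"
      unfolding \<delta>_def by (subst Min_gr_iff) auto
    then obtain k where k: "1 / real (Suc k) < \<delta>"
      using nat_approx_posE by blast
    have "1 / real (Suc k) < \<bar>\<phi> (T g x) - \<phi> x\<bar>" if "g \<in> cube n - {0}" for g
      using that by (intro less_le_trans[OF k]) (auto simp: \<delta>_def intro!: Min_le)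
    moreover define j where "j = \<lfloor>\<phi> x * real (Suc k)\<rfloor>"
    have "j \<le> \<phi> x * real (Suc k)" "\<phi> x * real (Suc k) < j + 1"
      unfolding j_def by linarith+
    then have "j / real (Suc k) \<le> \<phi> x" "\<phi> x < (j + 1) / real (Suc k)"
      by (simp_all only: pos_divide_le_eq pos_less_divide_eq of_nat_0_less_iff zero_less_Suc)
    ultimately have "x \<in> U (to_nat (k, j))"
      using x by (simp add: U_def)
    then show ?thesis ..
  qed
  define C where "C = rec_nat {} (\<lambda>i B. B \<union> {x \<in> U i. \<forall>g\<in>cube n. T g x \<notin> B})"
  have C_0: "C 0 = {}" and C_Suc: "C (Suc i) = C i \<union> {x \<in> U i. \<forall>g\<in>cube n. T g x \<notin> C i}" for i
    by (simp_all add: C_def)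
  have U_space: "U i \<subseteq> space M" for i
    by (rule sets.sets_into_space) simp
  have C_meas[measurable]: "C i \<in> sets M" for i
  proof (induction i)
    case (Suc i)
    have [measurable]: "C i \<in> sets M" by fact
    have "{x \<in> U i. \<forall>g\<in>cube n. T g x \<notin> C i} = U i \<inter> {x \<in> space M. \<forall>g\<in>cube n. T g x \<notin> C i}"
      using U_space by auto
    also have "\<dots> \<in> sets M" by measurable
    finally show ?case unfolding C_Suc by (intro sets.Un) (simp_all add: Suc.IH)
  qed (simp add: C_0)
  have C_mono: "i \<le> j \<Longrightarrow> C i \<subseteq> C j" for i j
    by (rule lift_Suc_mono_le[of C]) (auto simp: C_Suc)
  have stage: "\<exists>i. x \<in> U i \<and> x \<in> C (Suc i) \<and> (\<forall>g\<in>cube n. T g x \<notin> C i)" if "x \<in> C m" for x m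
    using that by (induction m) (auto simp: C_0 C_Suc)
  have C_sep: "T g x \<notin> C j" if x: "x \<in> space M" "x \<in> C i" and g: "g \<in> cube n" "g \<noteq> 0" for x g i j
  proof
    assume gx: "T g x \<in> C j"
    obtain i' where i': "x \<in> U i'" "x \<in> C (Suc i')" "\<And>g. g \<in> cube n \<Longrightarrow> T g x \<notin> C i'"
      using stage[OF x(2)] by blast
    obtain j' where j': "T g x \<in> U j'" "T g x \<in> C (Suc j')" "\<And>h. h \<in> cube n \<Longrightarrow> T h (T g x) \<notin> C j'"
      using stage[OF gx] by blast
    have "T (- g) (T g x) = x"
      using action_add[OF x(1), of "- g" g] action_zero[OF x(1)] by simp
    then have "x \<notin> C j'"
      using j'(3)[of "- g"] g by simp
    then have "j' < Suc i'"
      using i'(2) C_mono[of "Suc i'" j'] by force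
    moreover have "i' < Suc j'"
      using i'(3)[OF g(1)] j'(2) C_mono[of "Suc j'" i'] by force
    ultimately have "i' = j'" by simp
    then show False
      using U_sep[OF i'(1) g] j'(1) by simp
  qed
  show ?thesis
  proof (intro bexI[of _ "\<Union>i. C i"] conjI ballI impI)
    show "T g x \<notin> (\<Union>i. C i)" if "x \<in> space M" "g \<in> cube n" "g \<noteq> 0" "x \<in> (\<Union>i. C i)" for x g
      using that C_sep by blast
    show "AE x in M. \<exists>g\<in>cube n. T g x \<in> (\<Union>i. C i)"
      using orbit AE_space
    proof eventually_elim
      case (elim x)
      have "\<exists>i. x \<in> U i"
        by (rule U_cover) (use elim in simp_all)
      then obtain i where i: "x \<in> U i" ..
      show ?case
      proof (cases "\<forall>g\<in>cube n. T g x \<notin> C i")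
        case True
        then have "T 0 x \<in> C (Suc i)"
          using i elim by (simp add: C_Suc action_zero)
        then show ?thesis by (intro bexI[of _ 0]) auto
      qed auto
    qed
  qed simp
qed

text \<open>
  Translates of the marker set by vectors in the half-size cube are disjoint.
\<close>
lemma measure_marker_set:
  assumes [measurable]: "B \<in> sets M"
    and sep: "\<And>x g. x \<in> space M \<Longrightarrow> g \<in> cube n \<Longrightarrow> g \<noteq> 0 \<Longrightarrow> x \<in> B \<Longrightarrow> T g x \<notin> B"
  shows "card (cube (n div 2) :: (int ^ 'd) set) * measure M B \<le> measure M (space M)"
proof -
  let ?A = "\<lambda>g. {x \<in> space M. T g x \<in> B}"
  have "disjoint_family_on ?A (cube (n div 2))"
    unfolding disjoint_family_on_def
  proof (intro ballI impI)
    fix g h :: "int ^ 'd" assume gh: "g \<in> cube (n div 2)" "h \<in> cube (n div 2)" "g \<noteq> h"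
    have "g - h \<in> cube (n div 2 + n div 2)"
      using gh by (intro diff_in_cube)
    then have "g - h \<in> cube n"
      by (rule subsetD[OF cube_mono, rotated]) presburger
    moreover have "T g x = T (g - h) (T h x)" if "x \<in> space M" for x
      using action_add[OF that, of "g - h" h] by simp
    ultimately show "?A g \<inter> ?A h = {}"
      using sep gh(3) action_in_space by fastforce
  qed
  then have "(\<Sum>g\<in>cube (n div 2). measure M (?A g)) = measure M (\<Union>g\<in>cube (n div 2). ?A g)"
    by (intro finite_measure_finite_Union[symmetric]) auto
  also have "\<dots> \<le> measure M (space M)"
    by (rule bounded_measure)
  finally show ?thesis by (simp add: measure_translate)
qed

text \<open>
  A substitute for the Rokhlin lemma. Every point picks, among the markers in its cube, the one where
  \<open>\<phi>\<close> is smallest, and is coloured by the residue modulo \<open>K\<close> of its coordinate relative to that marker.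
  A point and its translates by \<open>F\<close> pick the same marker unless there is a marker in a
  thin shell around the cube. The measure of this exceptional event is at most the number of points in the shell times the measure of
  the marker set, which is small by the two preceding estimates. Along all other orbits the colour
  advances like the coordinate, so any of the \<open>K\<close> colours occurs exactly on one residue class; the colour
  of least measure gives \<open>A\<close>.
\<close>
lemma exists_periodic_pattern_set:
  fixes K :: nat and F :: "(int ^ 'd) set" and i0 :: 'd
  assumes K: "K > 0" and F: "finite F" and \<delta>: "\<delta> > 0"
  shows "\<exists>A \<in> sets M. \<exists>G \<in> sets M. measure M A \<le> measure M (space M) / K \<and>
           measure M (space M - G) \<le> \<delta> \<and>
           (\<forall>x\<in>G. \<exists>s<K. \<forall>h\<in>F. int K dvd h $ i0 - int s \<longrightarrow> T h x \<in> A)"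
proof -
  obtain \<phi> :: "'a \<Rightarrow> real" where \<phi>[measurable]: "\<phi> \<in> borel_measurable M"
    and orbit: "AE x in M. \<forall>g h. g \<noteq> h \<longrightarrow> \<phi> (T g x) \<noteq> \<phi> (T h x)"
    using exists_orbit_separating_function by blast
  obtain a where a: "F \<subseteq> cube a"
    using finite_set_in_some_cube[OF F] by blast
  define shell where "shell n = (cube (n + a) - cube (n - a) :: (int ^ 'd) set)" for n
  have "(\<lambda>n. real (card (shell n)) / real (card (cube (n div 2) :: (int ^ 'd) set)) * measure M (space M))
      \<longlonglongrightarrow> 0 * measure M (space M)"
    unfolding shell_def by (intro tendsto_intros card_shell_div_card_cube_tendsto)
  then have "\<forall>\<^sub>F n in sequentially. real (card (shell n)) / real (card (cube (n div 2) :: (int ^ 'd) set))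
      * measure M (space M) < \<delta>"
    using \<delta> by (intro order_tendstoD) auto
  from eventually_happens'[OF sequentially_bot eventually_conj[OF this eventually_ge_at_top[of a]]]
  obtain n where n: "n \<ge> a"
    and small: "real (card (shell n)) / real (card (cube (n div 2) :: (int ^ 'd) set)) * measure M (space M) < \<delta>"
    by (elim exE conjE)
  obtain B where B[measurable]: "B \<in> sets M"
    and sep: "\<And>x g. x \<in> space M \<Longrightarrow> g \<in> cube n \<Longrightarrow> g \<noteq> 0 \<Longrightarrow> x \<in> B \<Longrightarrow> T g x \<notin> B"
    and cover: "AE x in M. \<exists>g\<in>cube n. T g x \<in> B"
    using exists_marker_set[OF \<phi> orbit, of n] by (elim bexE conjE) simp
  \<comment> \<open>The points for which \<open>g\<close> leads to the chosen marker; strictness makes these sets disjoint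
    everywhere and not only almost everywhere.\<close>
  define W where "W g = {x \<in> space M. T g x \<in> B \<and>
      (\<forall>h\<in>cube n. h \<noteq> g \<longrightarrow> T h x \<in> B \<longrightarrow> \<phi> (T g x) < \<phi> (T h x))}" for g
  have [measurable]: "W g \<in> sets M" for g
    unfolding W_def by measurable
  have W_disjoint: "g = h" if "x \<in> W g" "x \<in> W h" "g \<in> cube n" "h \<in> cube n" for x g h
  proof (rule ccontr)
    assume "g \<noteq> h"
    then have "\<phi> (T g x) < \<phi> (T h x)" "\<phi> (T h x) < \<phi> (T g x)"
      using that by (auto simp: W_def)
    then show False by simp
  qed
  define C where "C r = (\<Union>g \<in> {g \<in> cube n. (- (g $ i0)) mod int K = int r}. W g)" for r
  have C_meas[measurable]: "C r \<in> sets M" for r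
    unfolding C_def by (intro sets.finite_UN) auto
  have "disjoint_family_on C {..<K}"
    unfolding disjoint_family_on_def C_def using W_disjoint by fastforce
  then have "(\<Sum>r<K. measure M (C r)) = measure M (\<Union>r<K. C r)"
    by (intro finite_measure_finite_Union[symmetric]) auto
  also have "\<dots> \<le> measure M (space M)"
    by (rule bounded_measure)
  finally have sum_C: "(\<Sum>r<K. measure M (C r)) \<le> measure M (space M)" .
  have "\<exists>r<K. measure M (C r) \<le> measure M (space M) / K"
  proof (rule ccontr)
    assume "\<not> ?thesis"
    then have "measure M (space M) / K < measure M (C r)" if "r < K" for r
      using that by (simp add: not_le)
    then have "(\<Sum>r<K. measure M (space M) / K) < (\<Sum>r<K. measure M (C r))"
      using K by (intro sum_strict_mono) auto
    then show False using sum_C K by simp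
  qed
  then obtain r where r: "r < K" "measure M (C r) \<le> measure M (space M) / K" by blast
  define G where "G = {x \<in> space M. (\<forall>g h. g \<noteq> h \<longrightarrow> \<phi> (T g x) \<noteq> \<phi> (T h x)) \<and>
      (\<exists>g\<in>cube n. T g x \<in> B) \<and> (\<forall>g\<in>shell n. T g x \<notin> B)}"
  have G_meas[measurable]: "G \<in> sets M"
    unfolding G_def shell_def by measurable
  have [simp]: "finite (shell n)" by (simp add: shell_def)
  have "measure M (space M - G) \<le> measure M (\<Union>g\<in>shell n. {x \<in> space M. T g x \<in> B})"
  proof (rule finite_measure_mono_AE)
    show "AE x in M. x \<in> space M - G \<longrightarrow> x \<in> (\<Union>g\<in>shell n. {x \<in> space M. T g x \<in> B})"
      using orbit cover by eventually_elim (auto simp: G_def)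
  qed (auto intro!: sets.finite_UN)
  also have "\<dots> \<le> (\<Sum>g\<in>shell n. measure M {x \<in> space M. T g x \<in> B})"
    by (intro finite_measure_subadditive_finite) auto
  also have "\<dots> = card (shell n) * measure M B"
    by (simp add: measure_translate)
  also have "\<dots> \<le> card (shell n) * (measure M (space M) / card (cube (n div 2) :: (int ^ 'd) set))"
    using measure_marker_set[OF B sep] by (intro mult_left_mono) (auto simp: field_simps card_cube)
  also have "\<dots> \<le> \<delta>" using small by (simp add: field_simps)
  finally have G_large: "measure M (space M - G) \<le> \<delta>" .
  have "\<exists>s<K. \<forall>h\<in>F. int K dvd h $ i0 - int s \<longrightarrow> T h x \<in> C r" if x: "x \<in> G" for x
  proof -
    have x_space: "x \<in> space M" and inj: "\<And>g h. g \<noteq> h \<Longrightarrow> \<phi> (T g x) \<noteq> \<phi> (T h x)"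
      and ex: "\<exists>g\<in>cube n. T g x \<in> B" and no_shell: "\<And>g. g \<in> shell n \<Longrightarrow> T g x \<notin> B"
      using x by (auto simp: G_def)
    define N where "N = {g \<in> cube n. T g x \<in> B}"
    have N: "finite N" "N \<noteq> {}" using ex by (auto simp: N_def)
    define g where "g = arg_min_on (\<lambda>g. \<phi> (T g x)) N"
    have g: "g \<in> N" and g_min: "\<And>h. h \<in> N \<Longrightarrow> \<phi> (T g x) \<le> \<phi> (T h x)"
      using N arg_min_least[OF N, where f = "\<lambda>g. \<phi> (T g x)"] unfolding g_def
      by (simp_all add: arg_min_if_finite)
    have inner: "h \<in> cube (n - a)" if "h \<in> cube (n + a)" "T h x \<in> B" for h
      using no_shell[of h] that by (auto simp: shell_def)
    have g_in: "g \<in> cube n" "T g x \<in> B" using g by (auto simp: N_def)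
    \<comment> \<open>The colour of \<open>T h x\<close> is \<open>h - g\<close> in the coordinate \<open>i0\<close>, hence equals \<open>r\<close> for \<open>h\<close> in the class
      of \<open>r + g\<close>.\<close>
    define s where "s = nat ((int r + g $ i0) mod int K)"
    have s: "int s = (int r + g $ i0) mod int K" "s < K"
      using K by (simp_all add: s_def nat_less_iff)
    have "T h x \<in> C r" if h: "h \<in> F" "int K dvd h $ i0 - int s" for h
    proof -
      have ha: "h \<in> cube a" using h a by blast
      have T_h: "T u (T h x) = T (u + h) x" for u
        using action_add[OF x_space] by simp
      have "g \<in> cube (n - a)"
        using g_in cube_mono[of n "n + a"] by (intro inner) auto
      then have gh: "g - h \<in> cube n"
        using diff_in_cube[OF _ ha, of g "n - a"] n by simp
      moreover have "(- ((g - h) $ i0)) mod int K = int r"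
      proof -
        have "int K dvd (int r + g $ i0) - int s"
          by (simp add: s(1))
        then have "int K dvd (h $ i0 - int s) - ((int r + g $ i0) - int s)"
          by (rule dvd_diff[OF h(2)])
        then have "int K dvd - ((g - h) $ i0) - int r"
          by (simp add: algebra_simps)
        then have "(- ((g - h) $ i0)) mod int K = int r mod int K"
          by (simp only: mod_eq_dvd_iff)
        then show ?thesis using r(1) by simp
      qed
      moreover have "T h x \<in> W (g - h)"
        unfolding W_def
      proof (intro CollectI conjI ballI impI)
        show "T h x \<in> space M" using x_space by (rule action_in_space)
        show "T (g - h) (T h x) \<in> B" using g_in by (simp add: T_h)
        fix u assume u: "u \<in> cube n" "u \<noteq> g - h" "T u (T h x) \<in> B"
        have "u + h \<in> cube (n + a)" using u(1) ha by (rule add_in_cube)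
        then have "u + h \<in> cube (n - a)" using u(3) by (intro inner) (simp_all add: T_h)
        then have "u + h \<in> N"
          using u(3) cube_mono[of "n - a" n] by (auto simp: N_def T_h)
        then have "\<phi> (T g x) \<le> \<phi> (T (u + h) x)" by (rule g_min)
        moreover have "\<phi> (T g x) \<noteq> \<phi> (T (u + h) x)"
          using u(2) by (intro inj) auto
        ultimately show "\<phi> (T (g - h) (T h x)) < \<phi> (T u (T h x))"
          by (simp add: T_h)
      qed
      ultimately show ?thesis unfolding C_def by blast
    qed
    with s(2) show ?thesis by blast
  qed
  with r(2) G_large C_meas G_meas show ?thesis by blast
qed

text \<open>
  At level \<open>b\<close> the function is at least \<open>h b\<close> on a pattern set of measure at most \<open>1 / K b\<close> (times the total
  mass). Almost every point lies in the good set of the pattern for all large \<open>b\<close>, by Borel and Cantelli,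
  and then has some class \<open>s\<close> for which its translates by \<open>Q b s\<close> all hit the pattern set. Combining the
  levels by an \<open>\<ell>\<^sup>p\<close> sum keeps the function in \<open>L\<^sup>p\<close>.
\<close>
lemma exists_function_large_on_periodic_sets:
  fixes K :: "nat \<Rightarrow> nat" and h :: "nat \<Rightarrow> real" and Q :: "nat \<Rightarrow> nat \<Rightarrow> (int ^ 'd) set" and i0 :: 'd
  assumes p: "1 \<le> p" and K: "\<And>b. K b > 0" and h: "\<And>b. 0 \<le> h b"
    and sum: "summable (\<lambda>b. h b powr p / K b)"
    and Q_fin: "\<And>b s. finite (Q b s)"
    and Q: "\<And>b s g. s < K b \<Longrightarrow> g \<in> Q b s \<Longrightarrow> int (K b) dvd g $ i0 - int s"
  shows "\<exists>f. in_Lp p M f \<and> (\<forall>x. 0 \<le> f x) \<and>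
           (AE x in M. \<forall>\<^sub>F b in sequentially. \<exists>s<K b. \<forall>g\<in>Q b s. h b \<le> f (T g x))"
proof -
  define pattern where "pattern b A G \<longleftrightarrow> A \<in> sets M \<and> G \<in> sets M \<and>
      measure M A \<le> measure M (space M) / K b \<and> measure M (space M - G) \<le> (1/2) ^ b \<and>
      (\<forall>x\<in>G. \<exists>s<K b. \<forall>g\<in>(\<Union>s<K b. Q b s). int (K b) dvd g $ i0 - int s \<longrightarrow> T g x \<in> A)" for b A G
  have "\<exists>A G. pattern b A G" for b
  proof -
    have "finite (\<Union>s<K b. Q b s)" "(0::real) < (1/2) ^ b" using Q_fin by simp_all
    from exists_periodic_pattern_set[OF K[of b] this, of i0] show ?thesis
      unfolding pattern_def Bex_def by iprover
  qed
  then obtain A G where AG: "\<And>b. pattern b (A b) (G b)"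
    by metis
  have A[measurable]: "A b \<in> sets M" and G[measurable]: "G b \<in> sets M"
    and A_small: "measure M (A b) \<le> measure M (space M) / K b"
    and G_large: "measure M (space M - G b) \<le> (1/2) ^ b" for b
    using AG[of b] by (simp_all add: pattern_def)
  define F where "F b x = h b powr p * indicator (A b) x" for b and x :: 'a
  have F_nonneg: "0 \<le> F b x" for b x
    by (simp add: F_def)
  have F_int: "integrable M (F b)" for b
    unfolding F_def by (intro integrable_mult_right integrable_real_indicator) (auto simp: emeasure_eq_measure)
  have F_integral: "(\<integral>x. F b x \<partial>M) = h b powr p * measure M (A b)" for b
    by (simp add: F_def)
  have sum_F: "summable (\<lambda>b. \<integral>x. F b x \<partial>M)"
  proof (rule summable_comparison_test')
    show "summable (\<lambda>b. measure M (space M) * (h b powr p / K b))"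
      using sum by (rule summable_mult)
    show "norm (\<integral>x. F b x \<partial>M) \<le> measure M (space M) * (h b powr p / K b)" for b
      using mult_left_mono[OF A_small[of b], of "h b powr p"] by (simp add: F_integral mult.commute)
  qed
  then have F_summable: "AE x in M. summable (\<lambda>b. F b x)"
    by (intro AE_summable_of_summable_integrals F_int F_nonneg)
  \<comment> \<open>The absolute value only matters on the null set where the series diverges, whose sum has no sign.\<close>
  define f where "f x = \<bar>\<Sum>b. F b x\<bar> powr (1 / p)" for x
  have "integrable M (\<lambda>x. \<Sum>b. F b x)"
  proof (rule integrable_suminf[OF F_int])
    show "AE x in M. summable (\<lambda>b. norm (F b x))"
      using F_summable by (simp add: F_nonneg)
    show "summable (\<lambda>b. \<integral>x. norm (F b x) \<partial>M)"
      using sum_F by (simp add: F_nonneg)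
  qed
  then have "integrable M (\<lambda>x. \<bar>\<Sum>b. F b x\<bar>)"
    by (rule integrable_abs)
  moreover have "\<bar>f x\<bar> powr p = \<bar>\<Sum>b. F b x\<bar>" for x
    using p by (simp add: f_def powr_powr)
  moreover have "f \<in> borel_measurable M"
    unfolding f_def F_def by measurable
  ultimately have Lp: "in_Lp p M f"
    by (simp add: in_Lp_def)
  have "summable (\<lambda>b. measure M (space M - G b))"
    by (rule summable_comparison_test'[OF summable_geometric[of "1/2::real"]]) (use G_large in auto)
  then have G_eventually: "AE x in M. \<forall>\<^sub>F b in sequentially. x \<in> space M - (space M - G b)"
    by (intro borel_cantelli_AE1) (auto simp: emeasure_eq_measure)
  have "AE x in M. \<forall>\<^sub>F b in sequentially. \<exists>s<K b. \<forall>g\<in>Q b s. h b \<le> f (T g x)"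
    using G_eventually AE_translate[OF F_summable]
  proof eventually_elim
    case (elim x)
    from elim(1) show ?case
    proof eventually_elim
      case (elim b)
      then have "x \<in> G b" by blast
      then obtain s where s: "s < K b"
        "\<forall>g\<in>(\<Union>s<K b. Q b s). int (K b) dvd g $ i0 - int s \<longrightarrow> T g x \<in> A b"
        using AG[of b] unfolding pattern_def by blast
      have "h b \<le> f (T g x)" if g: "g \<in> Q b s" for g
      proof -
        have "T g x \<in> A b"
          using s g Q[OF s(1) g] by blast
        then have "h b powr p = F b (T g x)"
          by (simp add: F_def)
        also have "F b (T g x) = (\<Sum>i\<in>{b}. F i (T g x))" by simp
        also have "\<dots> \<le> (\<Sum>i. F i (T g x))"
          using \<open>\<forall>g. summable (\<lambda>b. F b (T g x))\<close> F_nonneg by (intro sum_le_suminf) auto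
        also have "\<dots> \<le> \<bar>\<Sum>i. F i (T g x)\<bar>" by (rule abs_ge_self)
        finally have "(h b powr p) powr (1 / p) \<le> f (T g x)"
          unfolding f_def using p by (intro powr_mono2) auto
        then show ?thesis
          using p h[of b] by (simp add: powr_powr)
      qed
      with s(1) show ?case by blast
    qed
  qed
  moreover have "0 \<le> f x" for x
    by (simp add: f_def)
  ultimately show ?thesis
    using Lp by blast
qed

end

section \<open>Numerical parameters\<close>

lemma summable_powr_times_geometric:
  fixes c s :: real
  assumes "0 < c" "c < 1"
  shows "summable (\<lambda>n. (real n + 1) powr s * c ^ n)"
proof (rule ratio_test_convergence)
  have "(\<lambda>n. (1 - 1 / (real n + 2)) powr s / c) \<longlonglongrightarrow> (1 - 0) powr s / c"
  proof (intro tendsto_intros)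
    have "(\<lambda>n. 1 / real (n + 2)) \<longlonglongrightarrow> 0"
      using LIMSEQ_ignore_initial_segment[OF lim_const_over_n, of 1 2] .
    then show "(\<lambda>n. 1 / (real n + 2)) \<longlonglongrightarrow> 0" by (simp add: add.commute)
  qed (use assms in auto)
  moreover have "(1 - 1 / (real n + 2)) powr s / c =
      ((real n + 1) powr s * c ^ n) / ((real (Suc n) + 1) powr s * c ^ Suc n)" for n
  proof -
    have "1 - 1 / (real n + 2) = (real n + 1) / (real (Suc n) + 1)"
      by (simp add: field_simps)
    then show ?thesis using assms by (simp add: powr_divide)
  qed
  ultimately have "(\<lambda>n. ((real n + 1) powr s * c ^ n) / ((real (Suc n) + 1) powr s * c ^ Suc n)) \<longlonglongrightarrow> 1 / c"
    by simp
  then have "(\<lambda>n. ereal (((real n + 1) powr s * c ^ n) / ((real (Suc n) + 1) powr s * c ^ Suc n))) \<longlonglongrightarrow> ereal (1 / c)"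
    by (rule tendsto_ereal)
  then have "liminf (\<lambda>n. ereal (((real n + 1) powr s * c ^ n) / ((real (Suc n) + 1) powr s * c ^ Suc n))) = ereal (1 / c)"
    by (intro lim_imp_Liminf) auto
  moreover have "1 < ereal (1 / c)" using assms by (simp add: field_simps)
  ultimately show "1 < liminf (\<lambda>n. ereal (((real n + 1) powr s * c ^ n) / ((real (Suc n) + 1) powr s * c ^ Suc n)))"
    by simp
qed (use assms in simp)

text \<open>
  The exponent \<open>q\<close> is made critical: \<open>K b\<close> blocks of relative size \<open>1 / 2 ^ b\<close> are \<open>q\<close>-summable, but only by
  a polynomial margin, so that for every \<open>p < q\<close> a function of size \<open>2 ^ b\<close> (and even a bit larger) on
  sets of measure \<open>1 / K b\<close> has finite \<open>p\<close>-th moment.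
\<close>
lemma exists_class_counts:
  fixes q :: real
  assumes q: "1 < q"
  obtains K :: "nat \<Rightarrow> nat" where "\<And>b. K b > 0" "summable (\<lambda>b. K b * (1 / 2 ^ b) powr q)"
    "\<And>p. 1 \<le> p \<Longrightarrow> p < q \<Longrightarrow> summable (\<lambda>b. ((real b + 1) * 2 ^ b) powr p / K b)"
proof -
  define z where "z b = 2 powr (real b * q) / (real b + 1) ^ 2" for b :: nat
  define K where "K b = nat \<lceil>z b\<rceil>" for b
  have z: "0 < z b" for b by (simp add: z_def add_pos_nonneg)
  have K_le: "real (K b) \<le> z b + 1" and K_ge: "z b \<le> real (K b)" for b
    using z[of b] unfolding K_def by linarith+
  have pow2: "(2 ^ b :: real) powr t = 2 powr (real b * t)" for b t
    by (simp add: powr_realpow[symmetric] powr_powr)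
  have inv2: "(1 / 2 ^ b :: real) powr t = 1 / 2 powr (real b * t)" for b t
    by (simp add: powr_divide pow2)
  show ?thesis
  proof (rule that)
    show "K b > 0" for b using z[of b] by (simp add: K_def)
    show "summable (\<lambda>b. K b * (1 / 2 ^ b) powr q)"
    proof (rule summable_comparison_test')
      have "summable (\<lambda>b. inverse (real (Suc b) ^ 2))"
        by (subst summable_Suc_iff) (rule inverse_power_summable, simp)
      moreover have "summable (\<lambda>b. (1 / 2 powr q) ^ b)"
        using q by (intro summable_geometric) simp
      ultimately show "summable (\<lambda>b. inverse (real (Suc b) ^ 2) + (1 / 2 powr q) ^ b)"
        by (rule summable_add)
      fix b :: nat
      have "K b * (1 / 2 ^ b) powr q \<le> (z b + 1) * (1 / 2 powr (real b * q))"
        unfolding inv2 using K_le by (intro mult_right_mono) auto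
      also have "\<dots> = inverse (real (Suc b) ^ 2) + 1 / 2 powr (real b * q)"
        by (simp add: z_def field_simps)
      also have "1 / 2 powr (real b * q) = (1 / 2 powr q) ^ b"
        by (simp add: power_divide powr_powr powr_realpow[symmetric] mult.commute)
      finally show "norm (K b * (1 / 2 ^ b) powr q) \<le> inverse (real (Suc b) ^ 2) + (1 / 2 powr q) ^ b"
        by simp
    qed
    fix p :: real assume p: "1 \<le> p" "p < q"
    show "summable (\<lambda>b. ((real b + 1) * 2 ^ b) powr p / K b)"
    proof (rule summable_comparison_test')
      show "summable (\<lambda>b. (real b + 1) powr (p + 2) * (2 powr (p - q)) ^ b)"
        using p by (intro summable_powr_times_geometric) (auto simp: powr_less_one)
      fix b :: nat
      have "((real b + 1) * 2 ^ b) powr p / K b \<le> ((real b + 1) * 2 ^ b) powr p / z b"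
        using z[of b] K_ge[of b] by (intro divide_left_mono) auto
      also have "\<dots> = (real b + 1) powr p * (real b + 1) ^ 2 * (2 powr (real b * p) / 2 powr (real b * q))"
        by (simp add: z_def powr_mult pow2)
      also have "(real b + 1) powr p * (real b + 1) ^ 2 = (real b + 1) powr (p + 2)"
        by (simp add: powr_add)
      also have "2 powr (real b * p) / 2 powr (real b * q) = 2 powr (real b * (p - q))"
        by (simp add: powr_diff right_diff_distrib)
      also have "\<dots> = (2 powr (p - q)) ^ b"
        by (simp add: powr_powr powr_realpow[symmetric] mult.commute)
      finally show "norm (((real b + 1) * 2 ^ b) powr p / K b) \<le> (real b + 1) powr (p + 2) * (2 powr (p - q)) ^ b"
        by simp
    qed
  qed
qed

lemma summable_over_pairs:
  fixes w :: "nat \<Rightarrow> real" and K :: "nat \<Rightarrow> nat"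
  assumes w: "\<And>b. 0 \<le> w b" and sum: "summable (\<lambda>b. K b * w b)"
  shows "summable (\<lambda>k. case prod_decode k of (b, s) \<Rightarrow> if s < K b then w b else 0)"
proof (rule bounded_imp_summable)
  let ?g = "\<lambda>(b, s). if s < K b then w b else (0::real)"
  show "0 \<le> ?g (prod_decode k)" for k
    using w by (simp add: split_beta)
  fix n :: nat
  have b_le: "fst (prod_decode k) \<le> k" for k
    using le_prod_encode_1[of "fst (prod_decode k)" "snd (prod_decode k)"] by simp
  \<comment> \<open>Each pair is decoded from one index only, which bounds its level, so partial sums over indices are
    dominated by partial sums over levels.\<close>
  let ?I = "{k\<in>{..n}. snd (prod_decode k) < K (fst (prod_decode k))}"
  have "(\<Sum>k\<le>n. ?g (prod_decode k)) = (\<Sum>k\<in>?I. w (fst (prod_decode k)))"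
    by (subst sum.inter_filter) (simp_all add: split_beta)
  also have "\<dots> = (\<Sum>u\<in>prod_decode ` ?I. w (fst u))"
    by (subst sum.reindex) (auto intro: inj_on_subset[OF inj_prod_decode])
  also have "\<dots> \<le> (\<Sum>u\<in>(SIGMA b:{..n}. {..<K b}). w (fst u))"
  proof (rule sum_mono2)
    show "prod_decode ` ?I \<subseteq> (SIGMA b:{..n}. {..<K b})"
    proof
      fix u assume "u \<in> prod_decode ` ?I"
      then obtain k where "k \<le> n" "u = prod_decode k" "snd u < K (fst u)" by blast
      moreover from this have "fst u \<le> n" using b_le[of k] by simp
      ultimately show "u \<in> (SIGMA b:{..n}. {..<K b})" 
        by (metis SigmaI atMost_iff lessThan_iff prod.collapse)
    qed
  qed (use w in auto)
  also have "\<dots> = (\<Sum>b\<le>n. \<Sum>s<K b. w b)"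
    using sum.Sigma[of "{..n}" "\<lambda>b. {..<K b}" "\<lambda>b s. w b"] by (simp add: split_beta)
  also have "\<dots> = (\<Sum>b\<le>n. K b * w b)"
    by simp
  also have "\<dots> \<le> (\<Sum>b. K b * w b)"
    using w by (intro sum_le_suminf sum) auto
  finally show "(\<Sum>k\<le>n. ?g (prod_decode k)) \<le> (\<Sum>b. K b * w b)" .
qed

text \<open>
  The stage at \<open>N\<close> is the last block that the cube of size \<open>N\<close> can have met.
\<close>
lemma exists_stage_function:
  fixes m :: "nat \<Rightarrow> nat"
  assumes "strict_mono m"
  obtains \<kappa> where "filterlim \<kappa> at_top sequentially"
    "\<And>N. m 0 < N \<Longrightarrow> m (\<kappa> N) < N \<and> N \<le> m (Suc (\<kappa> N))"
proof -
  define \<kappa> where "\<kappa> N = (LEAST k. N \<le> m (Suc k))" for N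
  have "N \<le> m (Suc N)" for N
    using seq_suble[OF assms, of "Suc N"] by simp
  then have upper: "N \<le> m (Suc (\<kappa> N))" for N
    unfolding \<kappa>_def by (rule LeastI)
  have lower: "m (\<kappa> N) < N" if "m 0 < N" for N
  proof (cases "\<kappa> N")
    case (Suc k)
    then have "\<not> N \<le> m (Suc k)"
      using not_less_Least[of k "\<lambda>k. N \<le> m (Suc k)"] by (simp add: \<kappa>_def)
    then show ?thesis using Suc by simp
  qed (use that in simp)
  have "filterlim \<kappa> at_top sequentially"
    unfolding filterlim_at_top
  proof
    fix k
    show "\<forall>\<^sub>F N in sequentially. k \<le> \<kappa> N"
      using eventually_gt_at_top[of "m k"]
    proof eventually_elim
      case (elim N)
      then have "m k < m (Suc (\<kappa> N))" using upper[of N] by simp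
      then have "k < Suc (\<kappa> N)" by (simp only: strict_mono_less[OF assms])
      then show ?case by simp
    qed
  qed
  with that upper lower show ?thesis by blast
qed

section \<open>The perturbed set\<close>

text \<open>
  Dividing numerator and denominator of the average over \<open>S n\<close> by the size of \<open>D n\<close> exhibits it as a
  perturbation of the average over \<open>D n\<close>.
\<close>
lemma average_perturbation_converges:
  assumes sub: "\<And>n. D n \<subseteq> S n" and fin: "\<And>n. finite (S n)" and nonempty: "\<forall>\<^sub>F n in sequentially. D n \<noteq> {}"
    and count: "(\<lambda>n. card (S n - D n) / card (D n)) \<longlonglongrightarrow> 0"
    and extra: "(\<lambda>n. (\<Sum>g\<in>S n - D n. \<bar>f (T g x)\<bar>) / card (D n)) \<longlonglongrightarrow> 0"
    and lim: "(\<lambda>n. average T (D n) f x) \<longlonglongrightarrow> l"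
  shows "(\<lambda>n. average T (S n) f x) \<longlonglongrightarrow> l"
proof -
  define r where "r n = (\<Sum>g\<in>S n - D n. f (T g x)) / card (D n)" for n
  have "r \<longlonglongrightarrow> 0"
  proof (rule Lim_null_comparison[OF always_eventually extra], rule allI)
    show "norm (r n) \<le> (\<Sum>g\<in>S n - D n. \<bar>f (T g x)\<bar>) / card (D n)" for n
      unfolding r_def by (simp add: divide_right_mono sum_abs)
  qed
  then have "(\<lambda>n. (average T (D n) f x + r n) / (1 + card (S n - D n) / card (D n))) \<longlonglongrightarrow> (l + 0) / (1 + 0)"
    by (intro tendsto_intros lim count) auto
  moreover have "\<forall>\<^sub>F n in sequentially. (average T (D n) f x + r n) / (1 + card (S n - D n) / card (D n))
      = average T (S n) f x"
    using nonempty
  proof eventually_elim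
    case (elim n)
    have finD: "finite (D n)" using fin sub finite_subset by blast
    have card: "real (card (S n)) = card (D n) + card (S n - D n)"
      using card_Diff_subset[OF finD sub] card_mono[OF fin sub] by (simp add: of_nat_diff)
    have "(\<Sum>g\<in>S n. f (T g x)) = (\<Sum>g\<in>D n. f (T g x)) + (\<Sum>g\<in>S n - D n. f (T g x))"
      using sum.subset_diff[OF sub fin] by (simp add: add.commute)
    moreover have "card (D n) > 0" using elim finD by (simp add: card_gt_0_iff)
    moreover have "(a / u + b / u) / (1 + v / u) = (a + b) / (u + v)" if "0 < u" for a b u v :: real
    proof -
      have "1 + v / u = (u + v) / u" "a / u + b / u = (a + b) / u"
        using that by (simp_all add: add_divide_distrib)
      then show ?thesis using that by simp
    qed
    ultimately show ?case
      unfolding average_def r_def card by simp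
  qed
  ultimately show ?thesis
    by (simp add: tendsto_cong)
qed

theorem theorem2:
  fixes D :: "(int ^ 'd::finite) set" and q :: real
  assumes "1 < q"
    and "infinite D"
    and "lower_density D = 0"
    and "universally_good TYPE('a) q (truncations D)"
  shows "\<exists>S :: (int ^ 'd) set.
           perturbation (truncations S) (truncations D) \<and>
           universally_good TYPE('a) q (truncations S) \<and>
           (\<forall>p. 1 \<le> p \<and> p < q \<longrightarrow> universally_sweeping_out TYPE('a) p (truncations S))"
proof -
  obtain K :: "nat \<Rightarrow> nat" where K: "\<And>b. K b > 0" and K_sum: "summable (\<lambda>b. K b * (1 / 2 ^ b) powr q)"
    and K_sum_p: "\<And>p. 1 \<le> p \<Longrightarrow> p < q \<Longrightarrow> summable (\<lambda>b. ((real b + 1) * 2 ^ b) powr p / K b)"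
    by (rule exists_class_counts[OF assms(1)]) blast
  \<comment> \<open>Block \<open>k\<close> encodes a pair of a level and a residue class; when the class exceeds the modulus, the
    block is only a placeholder.\<close>
  define e :: "nat \<Rightarrow> real" where
    "e k = (case prod_decode k of (b, s) \<Rightarrow> if s < K b then 1 / 2 ^ b else 1 / 2 ^ k)" for k
  define level where "level k = fst (prod_decode k)" for k
  define res where "res k = snd (prod_decode k)" for k
  have e: "0 < e k" "e k \<le> 1" for k
    by (simp_all add: e_def split_beta)
  have e_sum: "summable (\<lambda>k. e k powr q)"
  proof (rule summable_comparison_test')
    have "summable (\<lambda>k. case prod_decode k of (b, s) \<Rightarrow> if s < K b then (1 / 2 ^ b) powr q else 0)"
      by (rule summable_over_pairs[OF _ K_sum]) simp
    moreover have "summable (\<lambda>k. (1 / 2 powr q) ^ k)"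
      using assms(1) by (intro summable_geometric) simp
    moreover have "(1 / 2 powr q) ^ k = (1 / 2 ^ k) powr q" for k
      by (simp add: powr_divide power_divide powr_powr powr_realpow[symmetric] mult.commute)
    ultimately show "summable (\<lambda>k. (case prod_decode k of (b, s) \<Rightarrow> if s < K b then (1 / 2 ^ b) powr q else 0)
        + (1 / 2 ^ k) powr q)"
      by (intro summable_add) simp_all
    show "norm (e k powr q) \<le> (case prod_decode k of (b, s) \<Rightarrow> if s < K b then (1 / 2 ^ b) powr q else 0)
        + (1 / 2 ^ k) powr q" for k
      by (simp add: e_def split_beta)
  qed
  have e_tendsto: "e \<longlonglongrightarrow> 0"
  proof -
    have "(\<lambda>k. (e k powr q) powr (1 / q)) \<longlonglongrightarrow> 0 powr (1 / q)"
      using summable_LIMSEQ_zero[OF e_sum] assms(1) by (intro tendsto_powr') auto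
    then show ?thesis using assms(1) e(1) by (simp add: powr_powr less_imp_le)
  qed
  \<comment> \<open>Any coordinate will do for the residue classes.\<close>
  define i0 :: 'd where "i0 = undefined"
  obtain L :: "nat \<Rightarrow> nat" and E :: "nat \<Rightarrow> (int ^ 'd) set" where
    L: "\<And>k. 0 < L k" "\<And>k. L k \<le> L (Suc k) div 2"
    and E_shell: "\<And>k. E k \<subseteq> cube (L k) - cube (L k div 2)"
    and E_class: "\<And>k v. v \<in> E k \<Longrightarrow> int (K (level k)) dvd v $ i0 - int (res k)"
    and E_large: "\<And>k. e k * card (truncations D (L k)) \<le> 2 * card (E k)"
    and E_small: "\<And>k. card (\<Union>j\<le>k. E j) \<le> 2 * e k * card (truncations D (L k))"
    and doubling: "\<And>k. card (truncations D (L k)) \<le> 3 ^ CARD('d) * card (truncations D (L k div 2))"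
    and nonempty: "\<And>k. truncations D (L k div 2) \<noteq> {}"
    using exists_sparse_blocks[OF assms(2,3), of e "\<lambda>k. K (level k)" i0 "\<lambda>k. int (res k)"] e K by metis
  define P where "P k = (\<Union>j\<le>k. E j)" for k
  define S where "S = D \<union> (\<Union>k. E k)"
  define m where "m k = L k div 2" for k
  define \<beta> where "\<beta> k = real (card (truncations D (m k)))" for k
  have E_fin: "finite (E k)" for k
    using E_shell[of k] finite_cube finite_subset by (metis finite_Diff)
  have P_fin: "finite (P k)" for k
    by (simp add: P_def E_fin)
  have \<beta>: "0 < \<beta> k" for k
    using nonempty[of k] by (simp add: \<beta>_def m_def card_gt_0_iff)
  have P_card: "card (P k) \<le> (2 * 3 ^ CARD('d) * e k) * \<beta> k" for k
  proof -
    have "real (card (truncations D (L k))) \<le> real (3 ^ CARD('d) * card (truncations D (m k)))"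
      unfolding m_def of_nat_le_iff by (rule doubling)
    then have "2 * e k * card (truncations D (L k)) \<le> 2 * e k * (3 ^ CARD('d) * \<beta> k)"
      using e(1)[of k] by (intro mult_left_mono) (auto simp: \<beta>_def)
    with E_small[of k] show ?thesis by (simp add: P_def mult_ac)
  qed
  have m_step: "m k < m (Suc k)" for k
    using L(1)[of k] L(2)[of k] by (simp add: m_def)
  then have m_mono: "strict_mono m"
    by (simp add: strict_mono_Suc_iff)
  obtain \<kappa> where \<kappa>: "filterlim \<kappa> at_top sequentially"
    and \<kappa>_stage: "\<And>N. m 0 < N \<Longrightarrow> m (\<kappa> N) < N \<and> N \<le> m (Suc (\<kappa> N))"
    by (rule exists_stage_function[OF m_mono]) blast
  have E_cube: "E j \<inter> cube N = {}" if "N \<le> m j" for j N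
    using E_shell[of j] cube_mono[OF that] by (auto simp: m_def)
  have added: "S \<inter> cube N - D \<subseteq> P k" if "N \<le> m (Suc k)" for N k
  proof
    fix v assume "v \<in> S \<inter> cube N - D"
    then obtain j where j: "v \<in> E j" "v \<in> cube N" by (auto simp: S_def)
    have "\<not> Suc k \<le> j"
    proof
      assume "Suc k \<le> j"
      then have "m (Suc k) \<le> m j" using m_mono by (simp add: strict_mono_less_eq)
      then show False using E_cube[of N j] j that by auto
    qed
    then show "v \<in> P k" using j by (auto simp: P_def)
  qed
  have sub: "truncations D N \<subseteq> truncations S N" for N
    by (auto simp: truncations_def S_def)
  have diff: "truncations S N - truncations D N = S \<inter> cube N - D" for N
    by (auto simp: truncations_def)
  have "infinite S" using assms(2) by (auto simp: S_def)
  note filters = nonempty_at_top_eq_sequentially[OF assms(2)] nonempty_at_top_eq_sequentially[OF \<open>infinite S\<close>]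
  \<comment> \<open>At every size, the points added so far form part of a finite stage \<open>P k\<close>, and \<open>D\<close> has by then at
    least \<open>\<beta> k\<close> points; both the perturbation property and goodness follow from this.\<close>
  have control: "\<forall>\<^sub>F N in sequentially. truncations S N - truncations D N \<subseteq> P (\<kappa> N) \<and>
      \<beta> (\<kappa> N) \<le> card (truncations D N)"
    using eventually_gt_at_top[of "m 0"]
  proof eventually_elim
    case (elim N)
    then show ?case
      using \<kappa>_stage[OF elim] added[of N "\<kappa> N"] card_truncations_mono[of "m (\<kappa> N)" N D]
      by (simp add: diff \<beta>_def)
  qed
  have count: "(\<lambda>N. card (truncations S N - truncations D N) / card (truncations D N)) \<longlonglongrightarrow> 0"
  proof (rule tendsto_sandwich[OF _ _ tendsto_const])
    have "(\<lambda>k. 2 * 3 ^ CARD('d) * e k) \<longlonglongrightarrow> 2 * 3 ^ CARD('d) * 0"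
      by (intro tendsto_intros e_tendsto)
    then show "(\<lambda>N. 2 * 3 ^ CARD('d) * e (\<kappa> N)) \<longlonglongrightarrow> 0"
      using filterlim_compose[OF _ \<kappa>] by simp
    show "\<forall>\<^sub>F N in sequentially. card (truncations S N - truncations D N) / card (truncations D N)
        \<le> 2 * 3 ^ CARD('d) * e (\<kappa> N)"
      using control
    proof eventually_elim
      case (elim N)
      have "card (truncations S N - truncations D N) / card (truncations D N) \<le> card (P (\<kappa> N)) / \<beta> (\<kappa> N)"
        using elim P_fin \<beta>[of "\<kappa> N"] by (intro frac_le) (auto intro: card_mono)
      also have "\<dots> \<le> 2 * 3 ^ CARD('d) * e (\<kappa> N)"
        using P_card[of "\<kappa> N"] \<beta>[of "\<kappa> N"] by (simp add: divide_le_eq)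
      finally show ?case .
    qed
  qed simp
  have perturbation: "perturbation (truncations S) (truncations D)"
  proof -
    have "(truncations S N - truncations D N) \<union> (truncations D N - truncations S N)
        = truncations S N - truncations D N" for N
      using sub by blast
    then show ?thesis
      unfolding perturbation_def filters using count by (simp only:)
  qed
  have good: "universally_good TYPE('a) q (truncations S)"
    unfolding universally_good_def filters
  proof (intro allI impI)
    fix M :: "'a measure" and T :: "int ^ 'd \<Rightarrow> 'a \<Rightarrow> 'a" and f
    assume act: "free_action M T" and f: "in_Lp q M f"
    interpret free_action M T by (rule act)
    have "AE x in M. \<exists>l. (\<lambda>n. average T (truncations D n) f x) \<longlonglongrightarrow> l"
      using assms(4) act f unfolding universally_good_def filters by blast
    moreover have "AE x in M. (\<lambda>k. (\<Sum>g\<in>P k. \<bar>f (T g x)\<bar>) / \<beta> k) \<longlonglongrightarrow> 0"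
    proof (rule sparse_sums_tendsto_zero[OF assms(1) f _ _ \<beta> P_card])
      show "0 \<le> 2 * 3 ^ CARD('d) * e k" for k using e(1)[of k] by simp
      have "(2 * 3 ^ CARD('d) * e k) powr q = (2 * 3 ^ CARD('d)) powr q * e k powr q" for k
        using e(1)[of k] by (intro powr_mult)
      then show "summable (\<lambda>k. (2 * 3 ^ CARD('d) * e k) powr q)"
        using e_sum by (simp add: summable_mult)
    qed
    ultimately show "AE x in M. \<exists>l. (\<lambda>n. average T (truncations S n) f x) \<longlonglongrightarrow> l"
    proof eventually_elim
      case (elim x)
      obtain l where l: "(\<lambda>n. average T (truncations D n) f x) \<longlonglongrightarrow> l" using elim(1) ..
      have "(\<lambda>N. (\<Sum>g\<in>truncations S N - truncations D N. \<bar>f (T g x)\<bar>) / card (truncations D N)) \<longlonglongrightarrow> 0"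
      proof (rule tendsto_sandwich[OF _ _ tendsto_const filterlim_compose[OF elim(2) \<kappa>]])
        show "\<forall>\<^sub>F N in sequentially. (\<Sum>g\<in>truncations S N - truncations D N. \<bar>f (T g x)\<bar>) / card (truncations D N)
            \<le> (\<Sum>g\<in>P (\<kappa> N). \<bar>f (T g x)\<bar>) / \<beta> (\<kappa> N)"
          using control
        proof eventually_elim
          case (elim N)
          then show ?case
            using P_fin \<beta>[of "\<kappa> N"] by (intro frac_le sum_nonneg) (auto intro: sum_mono2)
        qed
      qed (simp add: sum_nonneg)
      moreover have "\<forall>\<^sub>F N in sequentially. truncations D N \<noteq> {}"
        using control
      proof eventually_elim
        case (elim N)
        then show ?case using \<beta>[of "\<kappa> N"] by auto
      qed
      ultimately have "(\<lambda>n. average T (truncations S n) f x) \<longlonglongrightarrow> l"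
        using average_perturbation_converges[OF sub finite_truncations _ count _ l] by blast
      then show ?case ..
    qed
  qed
  have sweeping: "universally_sweeping_out TYPE('a) p (truncations S)" if p: "1 \<le> p" "p < q" for p
    unfolding universally_sweeping_out_def
  proof (intro allI impI)
    fix M :: "'a measure" and T :: "int ^ 'd \<Rightarrow> 'a \<Rightarrow> 'a"
    assume act: "free_action M T"
    interpret free_action M T by (rule act)
    \<comment> \<open>The factor \<open>2 ^ b\<close> cancels the relative size of a block; the factor \<open>b + 1\<close> makes the averages
      unbounded.\<close>
    define h where "h b = (real b + 1) * 2 ^ b" for b :: nat
    have h: "0 \<le> h b" for b by (simp add: h_def)
    have h_sum: "summable (\<lambda>b. h b powr p / K b)"
      unfolding h_def by (rule K_sum_p[OF p])
    have in_class: "int (K b) dvd g $ i0 - int s" if "g \<in> E (prod_encode (b, s))" for b s g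
      using E_class[OF that] by (simp add: level_def res_def)
    obtain f where f: "in_Lp p M f" "\<And>x. 0 \<le> f x"
      and large: "AE x in M. \<forall>\<^sub>F b in sequentially. \<exists>s<K b. \<forall>g\<in>E (prod_encode (b, s)). h b \<le> f (T g x)"
      using exists_function_large_on_periodic_sets[OF p(1) K h h_sum,
          of "\<lambda>b s. E (prod_encode (b, s))" i0] E_fin in_class by blast
    have "AE x in M. (SUP n\<in>{n. truncations S n \<noteq> {}}. ereal (average T (truncations S n) f x)) = \<infinity>"
      using large
    proof eventually_elim
      case (elim x)
      show ?case
      proof (rule SUP_PInfty)
        fix c :: nat
        have "\<forall>\<^sub>F b in sequentially. (\<exists>s<K b. \<forall>g\<in>E (prod_encode (b, s)). h b \<le> f (T g x)) \<and> 6 * c \<le> b"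
          using elim eventually_ge_at_top by (rule eventually_conj)
        from eventually_happens'[OF sequentially_bot this]
        obtain b s where b: "6 * c \<le> b" and s: "s < K b"
          and fE: "\<And>g. g \<in> E (prod_encode (b, s)) \<Longrightarrow> h b \<le> f (T g x)" by blast
        \<comment> \<open>The block of level \<open>b\<close> in the class that suits \<open>x\<close>.\<close>
        define k where "k = prod_encode (b, s)"
        define u where "u = real (card (truncations D (L k)))"
        have ek: "e k = 1 / 2 ^ b" using s by (simp add: e_def k_def)
        have "truncations D (m k) \<subseteq> truncations D (L k)"
          by (intro truncations_mono) (simp add: m_def)
        then have "truncations D (L k) \<noteq> {}" using nonempty[of k] by (auto simp: m_def)
        then have u: "0 < u" by (simp add: u_def card_gt_0_iff)
        have S_ne: "truncations S (L k) \<noteq> {}"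
          using \<open>truncations D (L k) \<noteq> {}\<close> sub by blast
        have E_sub: "E k \<subseteq> truncations S (L k)"
          using E_shell[of k] by (auto simp: truncations_def S_def)
        have "truncations S (L k) \<subseteq> truncations D (L k) \<union> P k"
          using added[of "L k" k] L(2)[of k] by (auto simp: truncations_def m_def)
        then have "card (truncations S (L k)) \<le> card (truncations D (L k) \<union> P k)"
          using P_fin by (intro card_mono) auto
        also have "\<dots> \<le> card (truncations D (L k)) + card (P k)" by (rule card_Un_le)
        finally have "real (card (truncations S (L k))) \<le> u + card (P k)"
          by (simp add: u_def)
        also have "card (P k) \<le> 2 * e k * u"
          using E_small[of k] by (simp add: P_def u_def)
        also have "\<dots> \<le> 2 * 1 * u"
          using e(2)[of k] u by (intro mult_right_mono) auto
        finally have S_card: "real (card (truncations S (L k))) \<le> 3 * u" by simp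
        have S_pos: "0 < real (card (truncations S (L k)))"
          using S_ne by (simp add: card_gt_0_iff)
        have "6 * real c \<le> real b" using b by (metis of_nat_le_iff of_nat_mult of_nat_numeral)
        then have "real c \<le> (real b + 1) / 6" by simp
        also have "(real b + 1) / 6 = (e k * u / 2) * h b / (3 * u)"
          using u by (simp add: ek h_def)
        also have "\<dots> \<le> (card (E k) * h b) / (3 * u)"
          using E_large[of k] u h[of b] by (intro divide_right_mono mult_right_mono) (auto simp: u_def)
        also have "\<dots> \<le> (card (E k) * h b) / card (truncations S (L k))"
          using S_card S_pos h[of b] by (intro divide_left_mono) auto
        also have "\<dots> \<le> average T (truncations S (L k)) f x"
          unfolding average_def
        proof (intro divide_right_mono)
          have "card (E k) * h b \<le> (\<Sum>g\<in>E k. f (T g x))"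
            using sum_mono[of "E k" "\<lambda>_. h b" "\<lambda>g. f (T g x)"] fE by (simp add: k_def)
          also have "\<dots> \<le> (\<Sum>g\<in>truncations S (L k). f (T g x))"
            using E_sub f(2) by (intro sum_mono2) auto
          finally show "card (E k) * h b \<le> (\<Sum>g\<in>truncations S (L k). f (T g x))" .
        qed simp
        finally show "\<exists>n\<in>{n. truncations S n \<noteq> {}}. ereal (real c) \<le> ereal (average T (truncations S n) f x)"
          using S_ne by (intro bexI[of _ "L k"]) auto
      qed
    qed
    with f(1) show "\<exists>f. in_Lp p M f \<and>
        (AE x in M. (SUP n\<in>{n. truncations S n \<noteq> {}}. ereal (average T (truncations S n) f x)) = \<infinity>)"
      by blast
  qed
  show ?thesis
    using perturbation good sweeping by blast
qed

end
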